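(* Let $p=p(n)$ satisfy $p=o(n^{-7/5})$ as $n\to\infty$. Then $$\mathbb P\big(H_3(n,p)\in\mathcal L_3(n)\big)=\exp\Big(-\tfrac14 n^4p^2+\tfrac23 n^5p^3-\tfrac{55}{24}n^6p^4+\tfrac32 n^3p^2+o(1)\Big)$$ as $n\to\infty$.
   Context: $H_3(n,p)$ is the random $3$-uniform hypergraph on vertex set $\{1,\dots,n\}$ in which each $3$-element subset is an edge independently with probability $p$. A hypergraph is linear if every pair of distinct hyperedges intersects in at most one vertex. $\mathcal L_3(n)$ is the set of all linear $3$-uniform hypergraphs with $n$ vertices. *)

theory Defs
  imports "HOL-Probability.Probability" "HOL-Library.Landau_Symbols"
begin

text \<open>A hypergraph on the fixed vertex set \<open>{1..n}\<close> is represented by its set of edges.\<close>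

definition triples :: "nat \<Rightarrow> nat set set" where
  "triples n = {e. e \<subseteq> {1..n} \<and> card e = 3}"

definition linear_hypergraph :: "'a set set \<Rightarrow> bool" where
  "linear_hypergraph E \<longleftrightarrow> (\<forall>e\<in>E. \<forall>f\<in>E. e \<noteq> f \<longrightarrow> card (e \<inter> f) \<le> 1)"

definition L3 :: "nat \<Rightarrow> nat set set set" where
  "L3 n = {E. E \<subseteq> triples n \<and> linear_hypergraph E}"

text \<open>
  Every triple carries an independent Bernoulli indicator, and the edges are the triples whose
  indicator is \<open>True\<close>. Since \<^const>\<open>bernoulli_pmf\<close> truncates its parameter to the unit
  interval, this is the intended distribution only for \<open>0 \<le> p \<le> 1\<close>.
\<close>

definition H3 :: "nat \<Rightarrow> real \<Rightarrow> nat set set pmf" where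
  "H3 n p = map_pmf (\<lambda>b. {e \<in> triples n. b e})
              (Pi_pmf (triples n) False (\<lambda>_. bernoulli_pmf p))"

end

theory Submission imports Defs begin

text \<open>
  Two triples conflict when they share two vertices, so a linear hypergraph is an independent set of
  the conflict graph and, with \<open>t = p / (1 - p)\<close>, the probability is \<open>(1 - p) ^ N * Z t\<close>, where
  \<open>N = n choose 3\<close> and \<open>Z\<close> is the hard-core partition function. The derivative of
  \<open>ln Z\<close> is the sum over all triples \<open>e\<close> of the probability \<open>r e\<close>, under the hard-core measure, that
  the closed neighbourhood of \<open>e\<close> is unoccupied, and a set \<open>S\<close> of pairwise compatible triples is
  occupied with probability \<open>t ^ card S\<close> times the probability that its neighbourhood is unoccupied.
  Inclusion-exclusion over the neighbourhood of \<open>e\<close>, a union of three cliques through \<open>e\<close>,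
  therefore gives \<open>r e + t * (\<Sum>f. r f) = 1 + 3 n\<^sup>2 t\<^sup>2 - 19 n\<^sup>3 t\<^sup>3 + \<dots>\<close>, with \<open>f\<close> ranging
  over the \<open>3 n - 8\<close> triples of that neighbourhood. This system is a contraction as
  soon as \<open>n t\<close> is small, hence \<open>r e = 1 - (3 n - 8) t + 12 n\<^sup>2 t\<^sup>2 - 55 n\<^sup>3 t\<^sup>3 + \<dots>\<close>; integrating
  in \<open>t\<close> yields the exponent.
\<close>

section \<open>The hard-core measure on linear hypergraphs\<close>

text \<open>Distinct members conflict when they share two vertices; taking \<open>2 \<le> card (e \<inter> f)\<close> without
  \<open>e \<noteq> f\<close> makes this the closed neighbourhood, containing \<open>S\<close> itself.\<close>

definition nbhd :: "nat \<Rightarrow> nat set set \<Rightarrow> nat set set" where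
  "nbhd n S = {f \<in> triples n. \<exists>e\<in>S. 2 \<le> card (e \<inter> f)}"

definition partition_fun :: "nat \<Rightarrow> real \<Rightarrow> real" where
  "partition_fun n t = (\<Sum>I\<in>L3 n. t ^ card I)"

text \<open>Expectation under the hard-core measure with fugacity \<open>t\<close>.\<close>

definition hc :: "nat \<Rightarrow> real \<Rightarrow> (nat set set \<Rightarrow> real) \<Rightarrow> real" where
  "hc n t F = (\<Sum>I\<in>L3 n. t ^ card I * F I) / partition_fun n t"

abbreviation incl :: "nat \<Rightarrow> real \<Rightarrow> nat set set \<Rightarrow> real" where
  "incl n t S \<equiv> hc n t (\<lambda>I. of_bool (S \<subseteq> I))"

text \<open>For \<open>S = {e}\<close> this is the quantity \<open>r e\<close> of the overview.
  Since \<open>S\<close> lies in its own closed neighbourhood, \<open>S\<close> itself must be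
  unoccupied as well.\<close>

abbreviation avoid :: "nat \<Rightarrow> real \<Rightarrow> nat set set \<Rightarrow> real" where
  "avoid n t S \<equiv> hc n t (\<lambda>I. of_bool (I \<inter> nbhd n S = {}))"

lemma finite_triples [simp]: "finite (triples n)"
  unfolding triples_def by (rule finite_subset[of _ "Pow {1..n}"]) auto

lemma finite_L3 [simp]: "finite (L3 n)"
  unfolding L3_def by (rule finite_subset[of _ "Pow (triples n)"]) auto

lemma card_triples: "card (triples n) = n choose 3"
  unfolding triples_def using n_subsets[of "{1..n}" 3] by simp

lemma triplesD: "e \<in> triples n \<Longrightarrow> finite e" "e \<in> triples n \<Longrightarrow> card e = 3"
  "e \<in> triples n \<Longrightarrow> e \<subseteq> {1..n}"
  unfolding triples_def by (auto intro: finite_subset)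

lemma L3_subset_triples: "I \<in> L3 n \<Longrightarrow> I \<subseteq> triples n"
  unfolding L3_def by auto

lemma finite_mem_L3: "I \<in> L3 n \<Longrightarrow> finite I"
  by (meson L3_subset_triples finite_subset finite_triples)

lemma L3_eqI: "I \<in> L3 n \<Longrightarrow> e \<in> I \<Longrightarrow> f \<in> I \<Longrightarrow> 2 \<le> card (e \<inter> f) \<Longrightarrow> e = f"
  unfolding L3_def linear_hypergraph_def by fastforce

lemma L3_mono: "I \<in> L3 n \<Longrightarrow> S \<subseteq> I \<Longrightarrow> S \<in> L3 n"
  unfolding L3_def linear_hypergraph_def by (auto simp: subset_iff)

lemma empty_in_L3 [simp]: "{} \<in> L3 n"
  unfolding L3_def linear_hypergraph_def by auto

lemma singleton_in_L3: "e \<in> triples n \<Longrightarrow> {e} \<in> L3 n"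
  unfolding L3_def linear_hypergraph_def by auto

lemma nbhd_subset_triples: "nbhd n S \<subseteq> triples n"
  unfolding nbhd_def by auto

lemma finite_nbhd [simp]: "finite (nbhd n S)"
  by (rule finite_subset[OF nbhd_subset_triples]) simp

lemma subset_nbhd: "S \<subseteq> triples n \<Longrightarrow> S \<subseteq> nbhd n S"
  unfolding nbhd_def by (auto simp: subset_iff triplesD(2) intro!: bexI)

lemma partition_fun_pos:
  assumes "0 \<le> t" shows "0 < partition_fun n t"
proof -
  have "t ^ card ({} :: nat set set) \<le> partition_fun n t"
    unfolding partition_fun_def using assms
    by (intro member_le_sum) auto
  then show ?thesis by simp
qed

lemma hc_one [simp]: "0 \<le> t \<Longrightarrow> hc n t (\<lambda>_. 1) = 1"
  using partition_fun_pos[of t n] unfolding hc_def partition_fun_def by simp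

lemma hc_add: "hc n t (\<lambda>I. F I + G I) = hc n t F + hc n t G"
  unfolding hc_def by (simp add: sum.distrib add_divide_distrib distrib_left)

lemma hc_diff: "hc n t (\<lambda>I. F I - G I) = hc n t F - hc n t G"
  unfolding hc_def by (simp add: sum_subtractf diff_divide_distrib right_diff_distrib)

lemma hc_sum: "hc n t (\<lambda>I. \<Sum>a\<in>A. F a I) = (\<Sum>a\<in>A. hc n t (F a))"
  unfolding hc_def by (simp add: sum_distrib_left sum.swap[of _ A] flip: sum_divide_distrib)

lemma hc_mono:
  assumes "0 \<le> t" "\<And>I. I \<in> L3 n \<Longrightarrow> F I \<le> G I"
  shows "hc n t F \<le> hc n t G"
  unfolding hc_def using assms partition_fun_pos[of t n]
  by (intro divide_right_mono sum_mono mult_left_mono) auto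

lemma hc_cong:
  assumes "\<And>I. I \<in> L3 n \<Longrightarrow> F I = G I"
  shows "hc n t F = hc n t G"
  unfolding hc_def using assms by simp

lemma hc_of_bool_bounds:
  assumes "0 \<le> t"
  shows "0 \<le> hc n t (\<lambda>I. of_bool (P I))" "hc n t (\<lambda>I. of_bool (P I)) \<le> 1"
proof -
  have "hc n t (\<lambda>I. 0) \<le> hc n t (\<lambda>I. of_bool (P I))" by (rule hc_mono) (use assms in auto)
  then show "0 \<le> hc n t (\<lambda>I. of_bool (P I))" by (simp add: hc_def)
  have "hc n t (\<lambda>I. of_bool (P I)) \<le> hc n t (\<lambda>I. 1)" by (rule hc_mono) (use assms in auto)
  then show "hc n t (\<lambda>I. of_bool (P I)) \<le> 1" using assms by simp
qed

text \<open>Two members of a linear hypergraph with two common vertices coincide, so deleting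
  \<open>S\<close> from \<open>I\<close> leaves nothing in the closed neighbourhood of
  \<open>S\<close>. Conversely, a configuration missing that neighbourhood has no conflict with
  \<open>S\<close>, and adding \<open>S\<close> keeps it linear.\<close>

lemma L3_extensions_bij:
  assumes S: "S \<in> L3 n"
  shows "bij_betw (\<lambda>J. J \<union> S) {J \<in> L3 n. J \<inter> nbhd n S = {}} {I \<in> L3 n. S \<subseteq> I}"
proof (rule bij_betw_byWitness[where f' = "\<lambda>I. I - S"])
  have SN: "S \<subseteq> nbhd n S" using S by (intro subset_nbhd L3_subset_triples)
  show "\<forall>J\<in>{J \<in> L3 n. J \<inter> nbhd n S = {}}. (J \<union> S) - S = J" using SN by blast
  show "\<forall>I\<in>{I \<in> L3 n. S \<subseteq> I}. (I - S) \<union> S = I" by blast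
  show "(\<lambda>J. J \<union> S) ` {J \<in> L3 n. J \<inter> nbhd n S = {}} \<subseteq> {I \<in> L3 n. S \<subseteq> I}"
  proof (clarsimp)
    fix J assume J: "J \<in> L3 n" "J \<inter> nbhd n S = {}"
    have *: "card (e \<inter> f) \<le> 1" if "e \<in> S" "f \<in> J" for e f
    proof -
      have "f \<in> triples n" "f \<notin> nbhd n S" using J that L3_subset_triples by blast+
      then show ?thesis using that unfolding nbhd_def by auto
    qed
    have **: "card (f \<inter> e) \<le> 1" if "e \<in> S" "f \<in> J" for e f
      using *[OF that] by (simp add: Int_commute)
    show "J \<union> S \<in> L3 n"
      using S J * ** unfolding L3_def linear_hypergraph_def by auto
  qed
  show "(\<lambda>I. I - S) ` {I \<in> L3 n. S \<subseteq> I} \<subseteq> {J \<in> L3 n. J \<inter> nbhd n S = {}}"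
  proof clarsimp
    fix I assume I: "I \<in> L3 n" "S \<subseteq> I"
    have "I - S \<in> L3 n" using I(1) by (rule L3_mono) auto
    moreover have "(I - S) \<inter> nbhd n S = {}"
      using L3_eqI[OF I(1)] I(2) unfolding nbhd_def by blast
    ultimately show "I - S \<in> L3 n \<and> (I - S) \<inter> nbhd n S = {}" by simp
  qed
qed

text \<open>Under the bijection \<open>J \<mapsto> J \<union> S\<close> the weight gains the factor
  \<open>t ^ card S\<close>, because \<open>J\<close> avoids the neighbourhood and hence is disjoint
  from \<open>S\<close>.\<close>

lemma incl_eq:
  assumes S: "S \<in> L3 n"
  shows "incl n t S = t ^ card S * avoid n t S"
proof -
  have SN: "S \<subseteq> nbhd n S" using S by (intro subset_nbhd L3_subset_triples)
  have "(\<Sum>I\<in>L3 n. t ^ card I * of_bool (S \<subseteq> I)) = (\<Sum>I\<in>{I\<in>L3 n. S \<subseteq> I}. t ^ card I)"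
    by (simp add: sum.inter_filter of_bool_def if_distrib cong: if_cong)
  also have "\<dots> = (\<Sum>J\<in>{J \<in> L3 n. J \<inter> nbhd n S = {}}. t ^ card (J \<union> S))"
    by (rule sum.reindex_bij_betw[OF L3_extensions_bij[OF S], symmetric])
  also have "\<dots> = (\<Sum>J\<in>{J \<in> L3 n. J \<inter> nbhd n S = {}}. t ^ card S * t ^ card J)"
  proof (rule sum.cong[OF refl])
    fix J assume J: "J \<in> {J \<in> L3 n. J \<inter> nbhd n S = {}}"
    then have "card (J \<union> S) = card J + card S"
      using SN S by (intro card_Un_disjoint finite_mem_L3[of _ n]) auto
    then show "t ^ card (J \<union> S) = t ^ card S * t ^ card J" by (simp add: power_add)
  qed
  also have "\<dots> = t ^ card S * (\<Sum>J\<in>L3 n. t ^ card J * of_bool (J \<inter> nbhd n S = {}))"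
    by (simp add: sum.inter_filter of_bool_def if_distrib sum_distrib_left cong: if_cong)
  finally show ?thesis unfolding hc_def by simp
qed

lemma incl_eq_0: "S \<notin> L3 n \<Longrightarrow> incl n t S = 0"
  unfolding hc_def using L3_mono by (force intro!: sum.neutral)

lemma incl_le:
  assumes "0 \<le> t" shows "incl n t S \<le> t ^ card S"
proof (cases "S \<in> L3 n")
  case True
  have "t ^ card S * avoid n t S \<le> t ^ card S * 1"
    by (intro mult_left_mono hc_of_bool_bounds) (use assms in auto)
  then show ?thesis using incl_eq[OF True] by simp
qed (use assms in \<open>simp add: incl_eq_0\<close>)

section \<open>Bonferroni bounds for the probability that a neighbourhood is unoccupied\<close>

lemma sum_of_bool_mem: 
  assumes "finite B"
  shows "(\<Sum>f\<in>B. of_bool ({f} \<subseteq> I)) = real (card (I \<inter> B))"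
  using assms by (simp add: of_bool_def Int_commute Int_def flip: sum.inter_filter)

text \<open>Union bound: if \<open>k\<close> members of \<open>I\<close> lie in the neighbourhood,
  then \<open>1 - k\<close> is at most the indicator of \<open>k = 0\<close>.\<close>

lemma avoid_ge:
  assumes "0 \<le> t"
  shows "1 - (\<Sum>f\<in>nbhd n S. incl n t {f}) \<le> avoid n t S"
proof -
  have "hc n t (\<lambda>I. 1 - (\<Sum>f\<in>nbhd n S. of_bool ({f} \<subseteq> I))) \<le> avoid n t S"
  proof (rule hc_mono[OF assms])
    fix I assume "I \<in> L3 n"
    show "1 - (\<Sum>f\<in>nbhd n S. of_bool ({f} \<subseteq> I)) \<le> (of_bool (I \<inter> nbhd n S = {}) :: real)"
      unfolding sum_of_bool_mem[OF finite_nbhd]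
      by (cases "I \<inter> nbhd n S = {}") (auto simp: Suc_le_eq card_gt_0_iff)
  qed
  then show ?thesis using assms by (simp only: hc_diff hc_sum hc_one)
qed

text \<open>Second-order Bonferroni bound in a crude form with ordered pairs. Each pair is jointly
  occupied with probability at most \<open>t ^ 2\<close>.\<close>

lemma avoid_le:
  assumes t: "0 \<le> t"
  shows "avoid n t S \<le> 1 - (\<Sum>f\<in>nbhd n S. incl n t {f}) + real (card (nbhd n S)) ^ 2 * t ^ 2"
proof -
  let ?B = "nbhd n S"
  have "avoid n t S \<le> hc n t (\<lambda>I. 1 - (\<Sum>f\<in>?B. of_bool ({f} \<subseteq> I)) 
      + (\<Sum>f\<in>?B. \<Sum>g\<in>?B - {f}. of_bool ({f, g} \<subseteq> I)))"
  proof (rule hc_mono[OF t])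
    fix I assume "I \<in> L3 n"
    define k where "k = card (I \<inter> ?B)"
    have "(\<Sum>g\<in>?B - {f}. of_bool ({f, g} \<subseteq> I)) = of_bool (f \<in> I) * (real k - 1)" if "f \<in> ?B" for f
    proof (cases "f \<in> I")
      case True
      have "(\<Sum>g\<in>?B - {f}. of_bool ({f, g} \<subseteq> I)) = (\<Sum>g\<in>?B - {f}. of_bool ({g} \<subseteq> I) :: real)"
        using True by (intro sum.cong) auto
      also have "\<dots> = (\<Sum>g\<in>?B. of_bool ({g} \<subseteq> I)) - 1"
        by (subst sum_diff1) (use True that in simp_all)
      finally show ?thesis using True sum_of_bool_mem[OF finite_nbhd] k_def by simp
    qed auto
    then have "(\<Sum>f\<in>?B. \<Sum>g\<in>?B - {f}. of_bool ({f, g} \<subseteq> I)) = (\<Sum>f\<in>?B. of_bool ({f} \<subseteq> I) * (real k - 1))"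
      by (intro sum.cong) auto
    also have "\<dots> = real k * (real k - 1)"
      unfolding sum_distrib_right[symmetric] sum_of_bool_mem[OF finite_nbhd] k_def ..
    finally have *: "(\<Sum>f\<in>?B. \<Sum>g\<in>?B - {f}. of_bool ({f, g} \<subseteq> I)) = real k * (real k - 1)" .
    have "I \<inter> ?B = {} \<longleftrightarrow> k = 0" unfolding k_def by simp
    \<comment> \<open>The pointwise right-hand side is
      \<open>1 - k + k * (k - 1) = (k - 1)\<^sup>2\<close>, which equals 1 at \<open>k = 0\<close>
      and is nonnegative elsewhere.\<close>
    moreover have "0 \<le> (real k - 1) * (real k - 1)" by (rule zero_le_square)
    ultimately show "of_bool (I \<inter> ?B = {}) \<le> 1 - (\<Sum>f\<in>?B. of_bool ({f} \<subseteq> I))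
       + (\<Sum>f\<in>?B. \<Sum>g\<in>?B - {f}. of_bool ({f, g} \<subseteq> I) :: real)"
      unfolding * sum_of_bool_mem[OF finite_nbhd] k_def[symmetric]
      by (cases k) (auto simp: algebra_simps)
  qed
  also have "\<dots> = 1 - (\<Sum>f\<in>?B. incl n t {f}) + (\<Sum>f\<in>?B. \<Sum>g\<in>?B - {f}. incl n t {f, g})"
    using t by (simp only: hc_diff hc_add hc_sum hc_one)
  also have "(\<Sum>f\<in>?B. \<Sum>g\<in>?B - {f}. incl n t {f, g}) \<le> (\<Sum>f\<in>?B. \<Sum>g\<in>?B - {f}. t ^ 2)"
  proof (intro sum_mono)
    fix f g assume "f \<in> ?B" "g \<in> ?B - {f}"
    then have "card {f, g} = 2" by (simp add: card_2_iff) blast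
    then show "incl n t {f, g} \<le> t ^ 2" using incl_le[OF t, of n "{f, g}"] by (simp only:)
  qed
  also have "\<dots> \<le> (\<Sum>f\<in>?B. real (card ?B) * t ^ 2)"
    using t by (intro sum_mono) (auto intro!: mult_right_mono card_mono)
  also have "\<dots> = real (card ?B) ^ 2 * t ^ 2" by (simp add: power2_eq_square)
  finally show ?thesis by simp
qed

section \<open>The neighbourhood of a triple\<close>

context
  fixes n :: nat and e :: "nat set"
  assumes e: "e \<in> triples n"
begin

lemma replace_vertex:
  assumes "v \<in> e" "x \<in> {1..n} - e"
  shows "insert x (e - {v}) \<in> triples n" "e \<inter> insert x (e - {v}) = e - {v}"
    "insert x (e - {v}) - e = {x}"
  using assms e triplesD[OF e] unfolding triples_def by (auto simp: card_insert_if)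

lemma inj_on_replace_vertex: "inj_on (\<lambda>(v, x). insert x (e - {v})) (e \<times> ({1..n} - e))"
proof (rule inj_onI, clarify)
  fix v x w y
  assume v: "v \<in> e" and x: "x \<in> {1..n}" "x \<notin> e" and w: "w \<in> e" and y: "y \<in> {1..n}" "y \<notin> e"
    and eq: "insert x (e - {v}) = insert y (e - {w})"
  have "e \<inter> insert x (e - {v}) = e - {v}" "e \<inter> insert y (e - {w}) = e - {w}"
    using x y by auto
  then have "e - {v} = e - {w}" using eq by simp
  moreover have "x = y" using v x w y eq by blast
  ultimately show "v = w \<and> x = y" using v w by blast
qed

text \<open>A triple sharing exactly two vertices with \<open>e\<close> misses one vertex
  \<open>v\<close> of \<open>e\<close> and has one vertex \<open>x\<close> outside. Fixing
  \<open>v\<close> gives one of the three cliques, and \<open>x\<close> parametrizes it.\<close>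

lemma nbhd_singleton:
  "nbhd n {e} = insert e ((\<lambda>(v, x). insert x (e - {v})) ` (e \<times> ({1..n} - e)))"
proof (rule set_eqI)
  fix f
  show "f \<in> nbhd n {e} \<longleftrightarrow> f \<in> insert e ((\<lambda>(v, x). insert x (e - {v})) ` (e \<times> ({1..n} - e)))"
  proof
    assume "f \<in> nbhd n {e}"
    then have f: "f \<in> triples n" and ef: "2 \<le> card (e \<inter> f)" unfolding nbhd_def by auto
    show "f \<in> insert e ((\<lambda>(v, x). insert x (e - {v})) ` (e \<times> ({1..n} - e)))"
    proof (cases "e \<subseteq> f")
      case True
      then have "e = f" using triplesD[OF f] triplesD[OF e] by (metis card_subset_eq)
      then show ?thesis by simp
    next
      case False
      then obtain v where v: "v \<in> e" "v \<notin> f" by auto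
      have sub: "e \<inter> f \<subseteq> e - {v}" using v by auto
      have c2: "card (e - {v}) = 2" using v triplesD[OF e] by simp
      have eq: "e \<inter> f = e - {v}"
        using sub c2 ef triplesD(1)[OF e] by (metis card_seteq finite_Diff)
      have "card (f - e) = card f - card (f \<inter> e)"
        using triplesD(1)[OF f] by (intro card_Diff_subset_Int) auto
      also have "\<dots> = 1"
        using triplesD(2)[OF f] c2 eq by (simp add: Int_commute)
      finally have "card (f - e) = 1" .
      then obtain x where x: "f - e = {x}" by (auto simp: card_1_singleton_iff)
      have "f = insert x (e - {v})" using x eq by blast
      moreover have "x \<in> {1..n} - e" using x triplesD(3)[OF f] by blast
      ultimately have "f = (\<lambda>(v, x). insert x (e - {v})) (v, x)" "(v, x) \<in> e \<times> ({1..n} - e)"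
        using v(1) by simp_all
      then show ?thesis by (intro insertI2 image_eqI)
    qed
  next
    assume "f \<in> insert e ((\<lambda>(v, x). insert x (e - {v})) ` (e \<times> ({1..n} - e)))"
    then consider "f = e" | v x where "v \<in> e" "x \<in> {1..n} - e" "f = insert x (e - {v})" by auto
    then show "f \<in> nbhd n {e}"
    proof cases
      case 1
      then show ?thesis using e triplesD(2)[OF e] unfolding nbhd_def by simp
    next
      case 2
      have "card (e \<inter> f) = 2" using replace_vertex(2)[OF 2(1,2)] 2 triplesD[OF e] by simp
      then show ?thesis using replace_vertex(1)[OF 2(1,2)] 2 unfolding nbhd_def by simp
    qed
  qed
qed

lemma card_complement: "card ({1..n} - e) = n - 3"
  using triplesD[OF e] by (simp add: card_Diff_subset)

lemma triples_ge_3: "3 \<le> n"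
  using triplesD[OF e] card_mono[of "{1..n}" e] by simp

lemma notin_replace: "e \<notin> (\<lambda>(v, x). insert x (e - {v})) ` (e \<times> ({1..n} - e))"
  by auto

text \<open>The count is \<open>1 + 3 * (n - 3)\<close>; the natural-number subtractions are exact
  because the existence of \<open>e\<close> forces \<open>3 \<le> n\<close>.\<close>

lemma card_nbhd_singleton: "card (nbhd n {e}) = 3 * n - 8"
proof -
  have "card (nbhd n {e}) = Suc (card (e \<times> ({1..n} - e)))"
    unfolding nbhd_singleton using notin_replace triplesD(1)[OF e]
    by (subst card_insert_disjoint) (simp_all only: card_image[OF inj_on_replace_vertex] finite_imageI finite_cartesian_product finite_Diff finite_atLeastAtMost not_False_eq_True)
  also have "\<dots> = Suc (3 * (n - 3))"
    by (simp only: card_cartesian_product card_complement triplesD(2)[OF e])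
  finally show ?thesis using triples_ge_3 by simp
qed

lemma sum_nbhd_singleton:
  "(\<Sum>f\<in>nbhd n {e}. h f) = h e + (\<Sum>v\<in>e. \<Sum>x\<in>{1..n} - e. h (insert x (e - {v})))" for h :: "nat set \<Rightarrow> real"
proof -
  have "(\<Sum>f\<in>nbhd n {e}. h f) = h e + (\<Sum>f\<in>(\<lambda>(v, x). insert x (e - {v})) ` (e \<times> ({1..n} - e)). h f)"
    unfolding nbhd_singleton using notin_replace triplesD(1)[OF e] by (subst sum.insert) auto
  also have "(\<Sum>f\<in>(\<lambda>(v, x). insert x (e - {v})) ` (e \<times> ({1..n} - e)). h f) =
    (\<Sum>(v, x)\<in>e \<times> ({1..n} - e). h (insert x (e - {v})))"
    by (subst sum.reindex[OF inj_on_replace_vertex]) (simp add: case_prod_unfold o_def)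
  finally show ?thesis by (simp add: sum.cartesian_product)
qed

text \<open>All triples \<open>insert x (e - {v})\<close> contain the pair \<open>e - {v}\<close>,
  so at most one of them belongs to a linear \<open>I\<close>. This turns a sum of indicators into a
  single indicator and makes the inclusion-exclusion exact.\<close>

lemma sum_clique:
  assumes I: "I \<in> L3 n" and v: "v \<in> e"
  shows "(\<Sum>x\<in>{1..n} - e. of_bool (insert x (e - {v}) \<in> I)) =
    (of_bool (\<exists>x\<in>{1..n} - e. insert x (e - {v}) \<in> I) :: real)"
proof (cases "\<exists>x\<in>{1..n} - e. insert x (e - {v}) \<in> I")
  case True
  then obtain x where x: "x \<in> {1..n} - e" "insert x (e - {v}) \<in> I" by blast
  have "insert y (e - {v}) \<in> I \<longleftrightarrow> y = x" if y: "y \<in> {1..n} - e" for y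
  proof
    assume "insert y (e - {v}) \<in> I"
    moreover have "2 \<le> card (insert y (e - {v}) \<inter> insert x (e - {v}))"
    proof -
      have "card (e - {v}) \<le> card (insert y (e - {v}) \<inter> insert x (e - {v}))"
        using triplesD(1)[OF e] by (intro card_mono) auto
      then show ?thesis using triplesD[OF e] v by simp
    qed
    ultimately have "insert y (e - {v}) = insert x (e - {v})" using x L3_eqI[OF I] by blast
    then show "y = x" using x y by blast
  qed (use x in auto)
  then have "(\<Sum>y\<in>{1..n} - e. of_bool (insert y (e - {v}) \<in> I)) = (\<Sum>y\<in>{1..n} - e. of_bool (y = x) :: real)"
    by (intro sum.cong) auto
  also have "\<dots> = 1" using x by (simp add: of_bool_def sum.delta)
  finally show ?thesis using True by simp
qed auto

lemma clique_excl:
  assumes "I \<in> L3 n" "e \<in> I" "v \<in> e" "x \<in> {1..n} - e"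
  shows "insert x (e - {v}) \<notin> I"
proof
  assume "insert x (e - {v}) \<in> I"
  moreover have "2 \<le> card (e \<inter> insert x (e - {v}))"
    using replace_vertex(2)[OF assms(3,4)] triplesD[OF e] assms by simp
  ultimately have "e = insert x (e - {v})" using assms L3_eqI by blast
  then show False using assms by blast
qed

text \<open>The neighbourhood consists of three cliques (the triples containing a given pair of \<open>e\<close>), each of
  which meets \<open>I\<close> at most once; the right-hand side is the expanded product of the three indicators
  that a clique is missed, corrected by \<open>e\<close>, which lies in all three.\<close>

lemma avoid_singleton_pointwise:
  assumes I: "I \<in> L3 n" and abc: "e = {a, b, c}" "a \<noteq> b" "a \<noteq> c" "b \<noteq> c"
  shows "(of_bool (I \<inter> nbhd n {e} = {}) :: real) = 1 - (\<Sum>f\<in>nbhd n {e}. of_bool ({f} \<subseteq> I))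
     + (\<Sum>x\<in>{1..n} - e. \<Sum>y\<in>{1..n} - e. of_bool ({insert x (e - {a}), insert y (e - {b})} \<subseteq> I))
     + (\<Sum>x\<in>{1..n} - e. \<Sum>y\<in>{1..n} - e. of_bool ({insert x (e - {a}), insert y (e - {c})} \<subseteq> I))
     + (\<Sum>x\<in>{1..n} - e. \<Sum>y\<in>{1..n} - e. of_bool ({insert x (e - {b}), insert y (e - {c})} \<subseteq> I))
     - (\<Sum>x\<in>{1..n} - e. \<Sum>y\<in>{1..n} - e. \<Sum>z\<in>{1..n} - e.
          of_bool ({insert x (e - {a}), insert y (e - {b}), insert z (e - {c})} \<subseteq> I))"
proof -
  define X where "X = {1..n} - e"
  \<comment> \<open>\<open>R v\<close> says that \<open>I\<close> contains a triple other than
    \<open>e\<close> through the pair \<open>e - {v}\<close>.\<close>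
  define R where "R v \<longleftrightarrow> (\<exists>x\<in>X. insert x (e - {v}) \<in> I)" for v
  define g where "g v x = insert x (e - {v})" for v x
  have S: "(\<Sum>x\<in>X. of_bool (g v x \<in> I)) = (of_bool (R v) :: real)" if "v \<in> e" for v
    unfolding R_def X_def g_def by (rule sum_clique[OF I that])
  have S2: "(\<Sum>x\<in>X. \<Sum>y\<in>X. of_bool ({g v x, g w y} \<subseteq> I)) = (of_bool (R v) * of_bool (R w) :: real)"
    if "v \<in> e" "w \<in> e" for v w
    unfolding S[OF that(1), symmetric] S[OF that(2), symmetric] sum_product by (simp add: of_bool_conj)
  have S3: "(\<Sum>x\<in>X. \<Sum>y\<in>X. \<Sum>z\<in>X. of_bool ({g a x, g b y, g c z} \<subseteq> I)) =
    (of_bool (R a) * (of_bool (R b) * of_bool (R c)) :: real)"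
    using abc by (simp add: of_bool_conj S flip: sum_distrib_left sum_distrib_right)
  have "(\<Sum>v\<in>e. \<Sum>x\<in>X. of_bool ({g v x} \<subseteq> I)) = (\<Sum>v\<in>e. of_bool (R v) :: real)"
    by (intro sum.cong) (simp_all add: S)
  also have "\<dots> = of_bool (R a) + of_bool (R b) + of_bool (R c)" using abc by simp
  finally have S1: "(\<Sum>f\<in>nbhd n {e}. of_bool ({f} \<subseteq> I)) =
     (of_bool (e \<in> I) + of_bool (R a) + of_bool (R b) + of_bool (R c) :: real)"
    unfolding sum_nbhd_singleton g_def X_def by simp
  have "I \<inter> nbhd n {e} = {} \<longleftrightarrow> e \<notin> I \<and> \<not> R a \<and> \<not> R b \<and> \<not> R c"
  proof -
    have "I \<inter> nbhd n {e} = {} \<longleftrightarrow> e \<notin> I \<and> I \<inter> (\<lambda>(v, x). insert x (e - {v})) ` (e \<times> X) = {}"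
      unfolding nbhd_singleton X_def by (simp add: Int_insert_right)
    also have "\<dots> \<longleftrightarrow> e \<notin> I \<and> (\<forall>v\<in>e. \<not> R v)"
    proof -
      have "I \<inter> h ` A = {} \<longleftrightarrow> (\<forall>p\<in>A. h p \<notin> I)" for h and A :: "(nat \<times> nat) set" by blast
      then show ?thesis unfolding R_def by simp
    qed
    finally have "I \<inter> nbhd n {e} = {} \<longleftrightarrow> e \<notin> I \<and> (\<forall>v\<in>e. \<not> R v)" .
    then show ?thesis using abc by simp
  qed
  \<comment> \<open>If \<open>e\<close> is occupied, then no other neighbour is, and both sides are
    0. Otherwise the identity is the expansion of the product of the three factors 1 minus the
    indicator of \<open>R v\<close>.\<close>
  moreover have "e \<in> I \<Longrightarrow> \<not> R a \<and> \<not> R b \<and> \<not> R c"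
    using clique_excl[OF I] abc unfolding R_def X_def by blast
  moreover have mem: "a \<in> e" "b \<in> e" "c \<in> e" using abc by auto
  ultimately show ?thesis
    unfolding S1 X_def[symmetric] g_def[symmetric] S3 S2[OF mem(1,2)] S2[OF mem(1,3)] S2[OF mem(2,3)]
    by (cases "e \<in> I"; cases "R a"; cases "R b"; cases "R c") simp_all
qed

lemma avoid_singleton:
  assumes t: "0 \<le> t" and abc: "e = {a, b, c}" "a \<noteq> b" "a \<noteq> c" "b \<noteq> c"
  shows "avoid n t {e} = 1 - (\<Sum>f\<in>nbhd n {e}. incl n t {f})
     + (\<Sum>x\<in>{1..n} - e. \<Sum>y\<in>{1..n} - e. incl n t {insert x (e - {a}), insert y (e - {b})})
     + (\<Sum>x\<in>{1..n} - e. \<Sum>y\<in>{1..n} - e. incl n t {insert x (e - {a}), insert y (e - {c})})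
     + (\<Sum>x\<in>{1..n} - e. \<Sum>y\<in>{1..n} - e. incl n t {insert x (e - {b}), insert y (e - {c})})
     - (\<Sum>x\<in>{1..n} - e. \<Sum>y\<in>{1..n} - e. \<Sum>z\<in>{1..n} - e.
          incl n t {insert x (e - {a}), insert y (e - {b}), insert z (e - {c})})"
  apply (rule trans[OF hc_cong])
   apply (erule avoid_singleton_pointwise[OF _ abc])
  using t by (simp only: hc_diff hc_add hc_sum hc_one)

end

section \<open>Estimates for occupation probabilities\<close>

lemma nbhd_UN: "nbhd n S = (\<Union>e\<in>S. nbhd n {e})"
  unfolding nbhd_def by auto

lemma card_nbhd_le:
  assumes "S \<in> L3 n"
  shows "card (nbhd n S) \<le> card S * (3 * n - 8)"
proof -
  have "card (nbhd n S) \<le> (\<Sum>e\<in>S. card (nbhd n {e}))"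
    by (subst nbhd_UN) (intro card_UN_le finite_mem_L3[OF assms])
  also have "\<dots> = (\<Sum>e\<in>S. 3 * n - 8)"
    using L3_subset_triples[OF assms] by (intro sum.cong card_nbhd_singleton) auto
  finally show ?thesis by simp
qed

text \<open>The sets \<open>f \<inter> h\<close> and \<open>g \<inter> h\<close> have at least two
  elements each and overlap in at most one, so together they cover all three vertices of
  \<open>h\<close>.\<close>

lemma common_neighbour_subset:
  assumes "card (f \<inter> g) \<le> 1" "h \<in> triples n" "finite f" "finite g"
    "2 \<le> card (f \<inter> h)" "2 \<le> card (g \<inter> h)"
  shows "h \<subseteq> f \<union> g"
proof -
  have "card (f \<inter> h) + card (g \<inter> h) = card ((f \<inter> h) \<union> (g \<inter> h)) + card ((f \<inter> h) \<inter> (g \<inter> h))"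
    by (rule card_Un_Int) (use assms in auto)
  moreover have "card ((f \<inter> h) \<inter> (g \<inter> h)) \<le> card (f \<inter> g)"
    by (rule card_mono) (use assms in auto)
  ultimately have "card h \<le> card ((f \<inter> h) \<union> (g \<inter> h))"
    using assms triplesD(2)[OF assms(2)] by linarith
  then have "(f \<inter> h) \<union> (g \<inter> h) = h"
    using triplesD(1)[OF assms(2)] by (intro card_seteq) auto
  then show ?thesis by blast
qed

text \<open>Common neighbours of compatible triples lie inside \<open>f \<union> g\<close>, which
  has at most 6 vertices. Hence the overlap is at most \<open>2 ^ 6 = 64\<close>, a bound
  independent of \<open>n\<close>.\<close>

lemma card_nbhd_pair_ge:
  assumes "{f, g} \<in> L3 n" "f \<noteq> g"
  shows "2 * (3 * n - 8) \<le> card (nbhd n {f, g}) + 64"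
proof -
  have f: "f \<in> triples n" and g: "g \<in> triples n" using L3_subset_triples[OF assms(1)] by auto
  have fg: "card (f \<inter> g) \<le> 1"
    using assms unfolding L3_def linear_hypergraph_def by auto
  have "card (nbhd n {f}) + card (nbhd n {g}) =
     card (nbhd n {f} \<union> nbhd n {g}) + card (nbhd n {f} \<inter> nbhd n {g})"
    by (rule card_Un_Int) auto
  moreover have "nbhd n {f} \<union> nbhd n {g} = nbhd n {f, g}" unfolding nbhd_def by auto
  moreover have "card (nbhd n {f} \<inter> nbhd n {g}) \<le> 64"
  proof -
    have "nbhd n {f} \<inter> nbhd n {g} \<subseteq> Pow (f \<union> g)"
      using common_neighbour_subset[OF fg _ triplesD(1)[OF f] triplesD(1)[OF g]]
      unfolding nbhd_def by auto
    then have "card (nbhd n {f} \<inter> nbhd n {g}) \<le> card (Pow (f \<union> g))"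
      using triplesD(1)[OF f] triplesD(1)[OF g] by (intro card_mono) auto
    also have "\<dots> = 2 ^ card (f \<union> g)" using triplesD(1)[OF f] triplesD(1)[OF g] by (simp add: card_Pow)
    also have "\<dots> \<le> 2 ^ (3 + 3)"
      using card_Un_le[of f g] triplesD(2)[OF f] triplesD(2)[OF g] by (intro power_increasing) auto
    finally show ?thesis by simp
  qed
  ultimately show ?thesis by (simp add: card_nbhd_singleton f g)
qed

lemma incl_singleton: "e \<in> triples n \<Longrightarrow> incl n t {e} = t * avoid n t {e}"
  by (subst incl_eq) (auto simp: singleton_in_L3)

text \<open>Union bound, in which every triple of the neighbourhood is occupied with probability at
  most \<open>t\<close>.\<close>

lemma avoid_ge_linear:
  assumes "0 \<le> t" "S \<in> L3 n"
  shows "1 - real (card S) * real (3 * n - 8) * t \<le> avoid n t S"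
proof -
  have "(\<Sum>f\<in>nbhd n S. incl n t {f}) \<le> (\<Sum>f\<in>nbhd n S. t)"
    using incl_le[OF assms(1), of n "{_}"] by (intro sum_mono) simp
  also have "\<dots> = real (card (nbhd n S)) * t" by simp
  also have "\<dots> \<le> real (card S * (3 * n - 8)) * t"
    using assms(1) card_nbhd_le[OF assms(2)] by (intro mult_right_mono) (simp_all only: of_nat_le_iff)
  finally show ?thesis using avoid_ge[OF assms(1), of n S] by simp
qed

text \<open>The lower bound is the union bound. For the upper one, the linear term of Bonferroni is
  bounded below by feeding the union bound back into each \<open>incl n t {h}\<close>.\<close>

lemma avoid_pair:
  assumes t: "0 \<le> t" and fg: "{f, g} \<in> L3 n" "f \<noteq> g"
  defines "D \<equiv> real (3 * n - 8)"
  shows "\<bar>avoid n t {f, g} - (1 - 2 * D * t)\<bar> \<le> 6 * D\<^sup>2 * t\<^sup>2 + 64 * t"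
proof -
  let ?B = "nbhd n {f, g}"
  define c where "c = real (card ?B)"
  have D: "0 \<le> D" unfolding D_def by simp
  have c2: "c \<le> 2 * D" "0 \<le> c"
    using card_nbhd_le[OF fg(1)] fg(2) unfolding c_def D_def by simp_all
  have c3: "2 * D \<le> c + 64"
    using card_nbhd_pair_ge[OF fg] unfolding c_def D_def by linarith
  have lower: "1 - 2 * D * t \<le> avoid n t {f, g}"
    using avoid_ge_linear[OF t fg(1)] fg(2) unfolding D_def by simp
  have "c * (t * (1 - D * t)) = (\<Sum>h\<in>?B. t * (1 - D * t))" unfolding c_def by simp
  also have "\<dots> \<le> (\<Sum>h\<in>?B. incl n t {h})"
  proof (intro sum_mono)
    fix h assume "h \<in> ?B"
    then have h: "h \<in> triples n" using nbhd_subset_triples by blast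
    have "1 - D * t \<le> avoid n t {h}"
      using avoid_ge_linear[OF t singleton_in_L3[OF h]] unfolding D_def by simp
    then show "t * (1 - D * t) \<le> incl n t {h}"
      unfolding incl_singleton[OF h] using t by (rule mult_left_mono)
  qed
  finally have "avoid n t {f, g} \<le> 1 - c * (t * (1 - D * t)) + c\<^sup>2 * t\<^sup>2"
    using avoid_le[OF t, of n "{f, g}"] unfolding c_def by linarith
  also have "\<dots> = 1 - c * t + (c * D + c\<^sup>2) * t\<^sup>2" by (simp add: algebra_simps power2_eq_square)
  \<comment> \<open>Here \<open>2 * D - 64 \<le> c \<le> 2 * D\<close>; the quadratic coefficient
    becomes \<open>2 * D\<^sup>2 + 4 * D\<^sup>2\<close>.\<close>
  also have "\<dots> \<le> 1 - (2 * D - 64) * t + (2 * D * D + (2 * D)\<^sup>2) * t\<^sup>2"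
    using c2 c3 D t
    by (intro add_mono diff_left_mono mult_right_mono power_mono) auto
  also have "\<dots> = 1 - 2 * D * t + (6 * D\<^sup>2 * t\<^sup>2 + 64 * t)" by (simp add: algebra_simps power2_eq_square)
  finally show ?thesis using lower t D by (auto simp: abs_le_iff intro: add_nonneg_nonneg)
qed

lemma sum_near:
  fixes h :: "'a \<Rightarrow> real"
  assumes "\<And>i. i \<in> A \<Longrightarrow> \<bar>h i - c\<bar> \<le> b"
  shows "\<bar>(\<Sum>i\<in>A. h i) - real (card A) * c\<bar> \<le> real (card A) * b"
proof -
  have "(\<Sum>i\<in>A. h i) - real (card A) * c = (\<Sum>i\<in>A. h i - c)" by (simp add: sum_subtractf)
  also have "\<bar>\<dots>\<bar> \<le> (\<Sum>i\<in>A. b)" by (rule order_trans[OF sum_abs sum_mono]) (use assms in auto)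
  finally show ?thesis by simp
qed

text \<open>Serves sums over distinct replacement vertices: \<open>S\<close> holds the indices that
  repeat an earlier vertex and contribute 0. Iterating with \<open>k = 1\<close> and
  \<open>k = 2\<close> produces falling factorials.\<close>

lemma sum_near_off:
  fixes h :: "'a \<Rightarrow> real"
  assumes "finite A" "S \<subseteq> A" "real (card S) = k" "\<And>i. i \<in> A - S \<Longrightarrow> \<bar>h i - c\<bar> \<le> b" "\<And>i. i \<in> S \<Longrightarrow> h i = 0"
  shows "\<bar>(\<Sum>i\<in>A. h i) - (real (card A) - k) * c\<bar> \<le> (real (card A) - k) * b"
proof -
  have "(\<Sum>i\<in>A. h i) = (\<Sum>i\<in>A - S. h i)" using assms by (intro sum.mono_neutral_right) auto
  moreover have "real (card (A - S)) = real (card A) - k"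
    using assms card_mono[OF assms(1,2)] finite_subset[OF assms(2,1)]
    by (auto simp: card_Diff_subset of_nat_diff)
  ultimately show ?thesis using sum_near[of "A - S" h c b] assms by simp
qed

lemma pair_in_L3:
  assumes "f \<in> triples n" "g \<in> triples n" "card (f \<inter> g) \<le> 1"
  shows "{f, g} \<in> L3 n"
  using assms unfolding L3_def linear_hypergraph_def by (auto simp: Int_commute)

lemma triple_in_L3:
  assumes "{f, g} \<in> L3 n" "{f, h} \<in> L3 n" "{g, h} \<in> L3 n"
  shows "{f, g, h} \<in> L3 n"
  using assms unfolding L3_def linear_hypergraph_def by (auto simp: Int_commute)

section \<open>Sums over compatible pairs and triples from different cliques\<close>

context
  fixes n :: nat and e :: "nat set"
  assumes e: "e \<in> triples n"
begin

text \<open>Neighbours from different cliques share the third vertex of \<open>e\<close>, and also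
  the new vertex if \<open>x = y\<close>. They are therefore compatible exactly when
  \<open>x \<noteq> y\<close>.\<close>

lemma card_replace_Int:
  assumes "u \<in> e" "v \<in> e" "u \<noteq> v" "x \<in> {1..n} - e" "y \<in> {1..n} - e"
  shows "card (insert x (e - {u}) \<inter> insert y (e - {v})) = (if x = y then 2 else 1)"
    "insert x (e - {u}) \<noteq> insert y (e - {v})"
proof -
  have c: "card (e - {u, v}) = 1" using assms triplesD[OF e] by (simp add: card_Diff_subset)
  show "card (insert x (e - {u}) \<inter> insert y (e - {v})) = (if x = y then 2 else 1)"
  proof (cases "x = y")
    case True
    then have "insert x (e - {u}) \<inter> insert y (e - {v}) = insert x (e - {u, v})" by auto
    then show ?thesis using c True assms triplesD(1)[OF e] by simp
  next
    case False
    then have "insert x (e - {u}) \<inter> insert y (e - {v}) = e - {u, v}" using assms by auto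
    then show ?thesis using c False by simp
  qed
  have "v \<in> insert x (e - {u})" "v \<notin> insert y (e - {v})" using assms by auto
  then show "insert x (e - {u}) \<noteq> insert y (e - {v})" by blast
qed

lemma replace_same_not_L3:
  assumes "u \<in> e" "v \<in> e" "u \<noteq> v" "x \<in> {1..n} - e"
    "insert x (e - {u}) \<in> S" "insert x (e - {v}) \<in> S"
  shows "S \<notin> L3 n"
  using card_replace_Int[OF assms(1-4) assms(4)] L3_eqI[OF _ assms(5,6)] by auto

lemma replace_pair_L3:
  assumes "u \<in> e" "v \<in> e" "u \<noteq> v" "x \<in> {1..n} - e" "y \<in> {1..n} - e" "x \<noteq> y"
  shows "{insert x (e - {u}), insert y (e - {v})} \<in> L3 n"
  using card_replace_Int(1)[OF assms(1-5)] assms by (intro pair_in_L3 replace_vertex(1)[OF e]) simp_all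

lemma replace_triple_L3:
  assumes "a \<in> e" "b \<in> e" "c \<in> e" "a \<noteq> b" "a \<noteq> c" "b \<noteq> c"
    "x \<in> {1..n} - e" "y \<in> {1..n} - e" "z \<in> {1..n} - e" "x \<noteq> y" "x \<noteq> z" "y \<noteq> z"
  shows "{insert x (e - {a}), insert y (e - {b}), insert z (e - {c})} \<in> L3 n"
  by (intro triple_in_L3 replace_pair_L3 assms)

text \<open>Only the \<open>m * (m - 1)\<close> choices with \<open>x \<noteq> y\<close> contribute,
  each \<open>t\<^sup>2\<close> times an avoidance probability known to first order in
  \<open>t\<close>.\<close>

lemma sum_incl_pairs:
  fixes t :: real
  defines "D \<equiv> real (3 * n - 8)" and "m \<equiv> real n - 3"
  assumes t: "0 \<le> t" and uv: "u \<in> e" "v \<in> e" "u \<noteq> v"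
  shows "\<bar>(\<Sum>x\<in>{1..n} - e. \<Sum>y\<in>{1..n} - e. incl n t {insert x (e - {u}), insert y (e - {v})})
     - m * ((m - 1) * (t\<^sup>2 * (1 - 2 * D * t)))\<bar> \<le> m * ((m - 1) * (t\<^sup>2 * (6 * D\<^sup>2 * t\<^sup>2 + 64 * t)))"
proof -
  have m: "real (card ({1..n} - e)) = m"
    unfolding m_def card_complement[OF e] using triples_ge_3[OF e] by (simp add: of_nat_diff)
  show ?thesis
    unfolding m[symmetric]
  proof (rule sum_near)
    fix x assume x: "x \<in> {1..n} - e"
    show "\<bar>(\<Sum>y\<in>{1..n} - e. incl n t {insert x (e - {u}), insert y (e - {v})}) -
          (real (card ({1..n} - e)) - 1) * (t\<^sup>2 * (1 - 2 * D * t))\<bar>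
         \<le> (real (card ({1..n} - e)) - 1) * (t\<^sup>2 * (6 * D\<^sup>2 * t\<^sup>2 + 64 * t))"
    proof (rule sum_near_off[where S = "{x}"])
      fix y assume y: "y \<in> {1..n} - e - {x}"
      have L: "{insert x (e - {u}), insert y (e - {v})} \<in> L3 n"
        by (rule replace_pair_L3) (use uv x y in auto)
      have ne: "insert x (e - {u}) \<noteq> insert y (e - {v})"
        by (rule card_replace_Int) (use uv x y in auto)
      then have c2: "card {insert x (e - {u}), insert y (e - {v})} = 2" by simp
      have "\<bar>incl n t {insert x (e - {u}), insert y (e - {v})} - t\<^sup>2 * (1 - 2 * D * t)\<bar> =
         t\<^sup>2 * \<bar>avoid n t {insert x (e - {u}), insert y (e - {v})} - (1 - 2 * D * t)\<bar>"
        unfolding incl_eq[OF L] c2 right_diff_distrib[symmetric] abs_mult by simp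
      also have "\<dots> \<le> t\<^sup>2 * (6 * D\<^sup>2 * t\<^sup>2 + 64 * t)"
        unfolding D_def by (intro mult_left_mono avoid_pair t L ne) simp
      finally show "\<bar>incl n t {insert x (e - {u}), insert y (e - {v})} - t\<^sup>2 * (1 - 2 * D * t)\<bar>
        \<le> t\<^sup>2 * (6 * D\<^sup>2 * t\<^sup>2 + 64 * t)" .
    next
      fix y assume y: "y \<in> {x}"
      then have "y = x" by simp
      then show "incl n t {insert x (e - {u}), insert y (e - {v})} = 0"
        by (intro incl_eq_0 replace_same_not_L3[OF uv x]) simp_all
    qed (use x in auto)
  qed
qed

text \<open>Distinct \<open>x\<close>, \<open>y\<close>, \<open>z\<close> give
  \<open>m * (m - 1) * (m - 2)\<close> compatible triples. Avoidance is replaced by 1 here, at a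
  total cost of order \<open>n ^ 4 * t ^ 4\<close>.\<close>

lemma sum_incl_triples:
  fixes t :: real
  defines "D \<equiv> real (3 * n - 8)" and "m \<equiv> real n - 3"
  assumes t: "0 \<le> t" and abc: "a \<in> e" "b \<in> e" "c \<in> e" "a \<noteq> b" "a \<noteq> c" "b \<noteq> c"
  shows "\<bar>(\<Sum>x\<in>{1..n} - e. \<Sum>y\<in>{1..n} - e. \<Sum>z\<in>{1..n} - e.
      incl n t {insert x (e - {a}), insert y (e - {b}), insert z (e - {c})})
     - m * ((m - 1) * ((m - 2) * t ^ 3))\<bar> \<le> m * ((m - 1) * ((m - 2) * (t ^ 3 * (3 * D * t))))"
proof -
  have m: "real (card ({1..n} - e)) = m"
    unfolding m_def card_complement[OF e] using triples_ge_3[OF e] by (simp add: of_nat_diff)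
  let ?T = "\<lambda>x y z. {insert x (e - {a}), insert y (e - {b}), insert z (e - {c})}"
  show ?thesis
    unfolding m[symmetric]
  proof (rule sum_near)
    fix x assume x: "x \<in> {1..n} - e"
    show "\<bar>(\<Sum>y\<in>{1..n} - e. \<Sum>z\<in>{1..n} - e. incl n t (?T x y z)) -
          (real (card ({1..n} - e)) - 1) * ((real (card ({1..n} - e)) - 2) * t ^ 3)\<bar>
         \<le> (real (card ({1..n} - e)) - 1) * ((real (card ({1..n} - e)) - 2) * (t ^ 3 * (3 * D * t)))"
    proof (rule sum_near_off[where S = "{x}"])
      fix y assume y: "y \<in> {1..n} - e - {x}"
      show "\<bar>(\<Sum>z\<in>{1..n} - e. incl n t (?T x y z)) - (real (card ({1..n} - e)) - 2) * t ^ 3\<bar>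
         \<le> (real (card ({1..n} - e)) - 2) * (t ^ 3 * (3 * D * t))"
      proof (rule sum_near_off[where S = "{x, y}"])
        fix z assume z: "z \<in> {1..n} - e - {x, y}"
        have L: "?T x y z \<in> L3 n"
          by (rule replace_triple_L3) (use abc x y z in auto)
        have "insert x (e - {a}) \<noteq> insert y (e - {b})" "insert x (e - {a}) \<noteq> insert z (e - {c})"
          "insert y (e - {b}) \<noteq> insert z (e - {c})"
          by (rule card_replace_Int; use abc x y z in auto)+
        then have c3: "card (?T x y z) = 3" by simp
        have "\<bar>incl n t (?T x y z) - t ^ 3\<bar> = \<bar>t ^ 3 * (avoid n t (?T x y z) - 1)\<bar>"
          unfolding incl_eq[OF L] c3 by (simp add: right_diff_distrib)
        also have "\<dots> = t ^ 3 * (1 - avoid n t (?T x y z))"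
          using hc_of_bool_bounds(2)[OF t] t unfolding abs_mult by simp
        also have "\<dots> \<le> t ^ 3 * (3 * D * t)"
          using avoid_ge_linear[OF t L] t unfolding c3 D_def by (intro mult_left_mono) simp_all
        finally show "\<bar>incl n t (?T x y z) - t ^ 3\<bar> \<le> t ^ 3 * (3 * D * t)" .
      next
        fix z assume "z \<in> {x, y}"
        then consider "z = x" | "z = y" by blast
        then show "incl n t (?T x y z) = 0"
        proof cases
          case 1
          show ?thesis unfolding 1 by (intro incl_eq_0 replace_same_not_L3[OF abc(1,3,5) x]) simp_all
        next
          case 2
          show ?thesis unfolding 2
            by (intro incl_eq_0 replace_same_not_L3[OF abc(2,3,6), of y]) (use y in simp_all)
        qed
      qed (use x y in auto)
    next
      fix y assume "y \<in> {x}"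
      then have "y = x" by simp
      then show "(\<Sum>z\<in>{1..n} - e. incl n t (?T x y z)) = 0"
        by (intro sum.neutral ballI incl_eq_0 replace_same_not_L3[OF abc(1,2,4) x]) simp_all
    qed (use x in auto)
  qed
qed

end

section \<open>The approximate local equation and its solution\<close>

text \<open>The first two terms absorb lower-order parts of the counts, the last the truncated
  expansion. Integration multiplies them by about \<open>n ^ 3 * t\<close>, giving
  \<open>n ^ 4 * t ^ 3\<close>, \<open>n ^ 5 * t ^ 4\<close> and \<open>n ^ 7 * t ^ 5\<close>; the
  last is of constant order at \<open>t = n powr (- 7 / 5)\<close>.\<close>

definition err :: "real \<Rightarrow> real \<Rightarrow> real" where
  "err x t = x * t\<^sup>2 + x\<^sup>2 * t ^ 3 + x ^ 4 * t ^ 4"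

text \<open>The solution of \<open>(1 + (3 x - 8) t) * r = 1 + 3 x\<^sup>2 t\<^sup>2 - 19 x\<^sup>3 t\<^sup>3\<close>, up to terms of size \<open>err\<close>.\<close>

definition occ :: "real \<Rightarrow> real \<Rightarrow> real" where
  "occ x t = 1 - (3 * x - 8) * t + 12 * x\<^sup>2 * t\<^sup>2 - 55 * x ^ 3 * t ^ 3"

lemma err_nonneg: "0 \<le> x \<Longrightarrow> 0 \<le> t \<Longrightarrow> 0 \<le> err x t"
  unfolding err_def by simp

lemma err_mono: "0 \<le> x \<Longrightarrow> 0 \<le> s \<Longrightarrow> s \<le> t \<Longrightarrow> err x s \<le> err x t"
  unfolding err_def by (intro add_mono mult_left_mono power_mono) auto

text \<open>Leading coefficients: three pairs of cliques give \<open>3 * x\<^sup>2\<close> at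
  \<open>t\<^sup>2\<close>. At \<open>t ^ 3\<close> their corrections give
  \<open>- 3 * 2 * 3 = - 18\<close> and the triple sum gives \<open>- 1\<close>, in total
  \<open>- 19\<close>.\<close>

lemma rook_expansion:
  fixes x t :: real
  defines "D \<equiv> 3 * x - 8" and "m \<equiv> x - 3"
  assumes x: "5 \<le> x" and t: "0 \<le> t"
  shows "\<bar>3 * (m * ((m - 1) * (t\<^sup>2 * (1 - 2 * D * t)))) - m * ((m - 1) * ((m - 2) * t ^ 3))
      - (3 * x\<^sup>2 * t\<^sup>2 - 19 * x ^ 3 * t ^ 3)\<bar> \<le> 21 * (x * t\<^sup>2) + 186 * (x\<^sup>2 * t ^ 3)"
    "m * ((m - 1) * (t\<^sup>2 * (6 * D\<^sup>2 * t\<^sup>2 + 64 * t))) \<le> 54 * (x ^ 4 * t ^ 4) + 64 * (x\<^sup>2 * t ^ 3)"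
    "m * ((m - 1) * ((m - 2) * (t ^ 3 * (3 * D * t)))) \<le> 9 * (x ^ 4 * t ^ 4)"
proof -
  have D: "0 \<le> D" "D \<le> 3 * x" and m: "0 \<le> m" "0 \<le> m - 1" "0 \<le> m - 2" "m \<le> x" "m - 1 \<le> x" "m - 2 \<le> x"
    unfolding D_def m_def using x by auto
  have "3 * (m * ((m - 1) * (t\<^sup>2 * (1 - 2 * D * t)))) - m * ((m - 1) * ((m - 2) * t ^ 3))
      - (3 * x\<^sup>2 * t\<^sup>2 - 19 * x ^ 3 * t ^ 3) = - ((21 * x - 36) * t\<^sup>2) + (186 * x\<^sup>2 - 599 * x + 636) * t ^ 3"
    unfolding D_def m_def by (simp add: algebra_simps power2_eq_square power3_eq_cube)
  also have "\<bar>\<dots>\<bar> \<le> (21 * x - 36) * t\<^sup>2 + \<bar>186 * x\<^sup>2 - 599 * x + 636\<bar> * t ^ 3"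
    using x t by (intro order_trans[OF abs_triangle_ineq]) (simp add: abs_mult)
  also have "\<dots> \<le> (21 * x) * t\<^sup>2 + (186 * x\<^sup>2) * t ^ 3"
  proof (intro add_mono mult_right_mono)
    \<comment> \<open>This puts \<open>599 * x - 636\<close> between 0 and
      \<open>372 * x\<^sup>2\<close>.\<close>
    have "5 * x \<le> x * x" using x by (intro mult_right_mono) auto
    then show "\<bar>186 * x\<^sup>2 - 599 * x + 636\<bar> \<le> 186 * x\<^sup>2"
      using x unfolding power2_eq_square by (intro abs_leI) linarith+
  qed (use x t in auto)
  finally show "\<bar>3 * (m * ((m - 1) * (t\<^sup>2 * (1 - 2 * D * t)))) - m * ((m - 1) * ((m - 2) * t ^ 3))
      - (3 * x\<^sup>2 * t\<^sup>2 - 19 * x ^ 3 * t ^ 3)\<bar> \<le> 21 * (x * t\<^sup>2) + 186 * (x\<^sup>2 * t ^ 3)" by (simp add: algebra_simps)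
  have "m * ((m - 1) * (t\<^sup>2 * (6 * D\<^sup>2 * t\<^sup>2 + 64 * t))) \<le> x * (x * (t\<^sup>2 * (6 * (3 * x)\<^sup>2 * t\<^sup>2 + 64 * t)))"
    using D m x t by (intro mult_mono add_mono power_mono mult_nonneg_nonneg add_nonneg_nonneg) auto
  also have "\<dots> = 54 * (x ^ 4 * t ^ 4) + 64 * (x\<^sup>2 * t ^ 3)" by (simp add: algebra_simps power2_eq_square power3_eq_cube power4_eq_xxxx)
  finally show "m * ((m - 1) * (t\<^sup>2 * (6 * D\<^sup>2 * t\<^sup>2 + 64 * t))) \<le> 54 * (x ^ 4 * t ^ 4) + 64 * (x\<^sup>2 * t ^ 3)" .
  have "m * ((m - 1) * ((m - 2) * (t ^ 3 * (3 * D * t)))) \<le> x * (x * (x * (t ^ 3 * (3 * (3 * x) * t))))"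
    using D m x t by (intro mult_mono mult_nonneg_nonneg) auto
  also have "\<dots> = 9 * (x ^ 4 * t ^ 4)" by (simp add: algebra_simps power2_eq_square power3_eq_cube power4_eq_xxxx)
  finally show "m * ((m - 1) * ((m - 2) * (t ^ 3 * (3 * D * t)))) \<le> 9 * (x ^ 4 * t ^ 4)" .
qed

lemma avoid_local_equation:
  assumes e: "e \<in> triples n" and n: "5 \<le> n" and t: "0 \<le> t"
  shows "\<bar>avoid n t {e} + t * (\<Sum>f\<in>nbhd n {e}. avoid n t {f})
     - (1 + 3 * (real n)\<^sup>2 * t\<^sup>2 - 19 * real n ^ 3 * t ^ 3)\<bar> \<le> 400 * err (real n) t"
proof -
  obtain a b c where abc: "e = {a, b, c}" "a \<noteq> b" "a \<noteq> c" "b \<noteq> c"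
    using triplesD(2)[OF e] by (auto simp: card_3_iff)
  define x where "x = real n"
  define D where "D = real (3 * n - 8)"
  have D: "D = 3 * x - 8" unfolding D_def x_def using n by (simp add: of_nat_diff)
  have mem: "a \<in> e" "b \<in> e" "c \<in> e" using abc by auto
  define W where "W u v = (\<Sum>x\<in>{1..n} - e. \<Sum>y\<in>{1..n} - e. incl n t {insert x (e - {u}), insert y (e - {v})})" for u v
  define W3 where "W3 = (\<Sum>x\<in>{1..n} - e. \<Sum>y\<in>{1..n} - e. \<Sum>z\<in>{1..n} - e.
      incl n t {insert x (e - {a}), insert y (e - {b}), insert z (e - {c})})"
  have eq: "avoid n t {e} + t * (\<Sum>f\<in>nbhd n {e}. avoid n t {f}) = 1 + W a b + W a c + W b c - W3"
  proof -
    have "t * (\<Sum>f\<in>nbhd n {e}. avoid n t {f}) = (\<Sum>f\<in>nbhd n {e}. incl n t {f})"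
      unfolding sum_distrib_left using nbhd_subset_triples
      by (intro sum.cong refl incl_singleton[symmetric]) auto
    then show ?thesis using avoid_singleton[OF e t abc] unfolding W_def W3_def by linarith
  qed
  \<comment> \<open>\<open>A\<close> is the main term of each of the three pair sums,
    \<open>B\<close> below that of the triple sum.\<close>
  define A where "A = (x - 3) * ((x - 3 - 1) * (t\<^sup>2 * (1 - 2 * D * t)))"
  have W: "\<bar>W u v - A\<bar> \<le> 54 * (x ^ 4 * t ^ 4) + 64 * (x\<^sup>2 * t ^ 3)" if "u \<in> e" "v \<in> e" "u \<noteq> v" for u v
    unfolding W_def A_def D_def x_def
    by (rule order_trans[OF sum_incl_pairs[OF e t that]])
      (use rook_expansion(2)[of x t] n t D in \<open>simp add: x_def D_def\<close>)
  define B where "B = (x - 3) * ((x - 3 - 1) * ((x - 3 - 2) * t ^ 3))"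
  have W3: "\<bar>W3 - B\<bar> \<le> 9 * (x ^ 4 * t ^ 4)"
    unfolding W3_def B_def D_def x_def
    by (rule order_trans[OF sum_incl_triples[OF e t mem abc(2-4)]])
      (use rook_expansion(3)[of x t] n t D in \<open>simp add: x_def D_def\<close>)
  have R: "\<bar>3 * A - B - (3 * x\<^sup>2 * t\<^sup>2 - 19 * x ^ 3 * t ^ 3)\<bar> \<le> 21 * (x * t\<^sup>2) + 186 * (x\<^sup>2 * t ^ 3)"
    unfolding A_def B_def D by (rule rook_expansion) (use n t x_def in auto)
  have nn: "0 \<le> x * t\<^sup>2" "0 \<le> x\<^sup>2 * t ^ 3" "0 \<le> x ^ 4 * t ^ 4" using t unfolding x_def by auto
  have tri: "\<bar>1 + w1 + w2 + w3 - w4 - (1 + q - r)\<bar> \<le>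
      \<bar>w1 - A\<bar> + \<bar>w2 - A\<bar> + \<bar>w3 - A\<bar> + \<bar>w4 - B\<bar> + \<bar>3 * A - B - (q - r)\<bar>" for w1 w2 w3 w4 q r
    by linarith
  have "\<bar>avoid n t {e} + t * (\<Sum>f\<in>nbhd n {e}. avoid n t {f}) - (1 + 3 * x\<^sup>2 * t\<^sup>2 - 19 * x ^ 3 * t ^ 3)\<bar>
     \<le> (54 * (x ^ 4 * t ^ 4) + 64 * (x\<^sup>2 * t ^ 3)) + (54 * (x ^ 4 * t ^ 4) + 64 * (x\<^sup>2 * t ^ 3))
       + (54 * (x ^ 4 * t ^ 4) + 64 * (x\<^sup>2 * t ^ 3)) + 9 * (x ^ 4 * t ^ 4) + (21 * (x * t\<^sup>2) + 186 * (x\<^sup>2 * t ^ 3))"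
    unfolding eq by (rule order_trans[OF tri]) (intro add_mono W W3 R mem abc)
  \<comment> \<open>The collected coefficients of \<open>x * t\<^sup>2\<close>,
    \<open>x\<^sup>2 * t ^ 3\<close> and \<open>x ^ 4 * t ^ 4\<close> are 21, 378 and 171.\<close>
  also have "\<dots> \<le> 400 * err x t" 
  proof -
    have "54 * a + 64 * b + (54 * a + 64 * b) + (54 * a + 64 * b) + 9 * a + (21 * c + 186 * b) \<le> 400 * (c + b + a)"
      if "0 \<le> a" "0 \<le> b" "0 \<le> c" for a b c :: real
      using that by simp
    then show ?thesis unfolding err_def using nn by blast
  qed
  finally show ?thesis unfolding x_def .
qed

text \<open>The coefficients of \<open>occ\<close> come from power-series division by
  \<open>1 + (3 * x - 8) * t\<close>: to leading order in \<open>x\<close>,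
  \<open>12 = 3 + 3 * 3\<close> and \<open>55 = 19 + 3 * 12\<close>.\<close>

lemma occ_local_equation:
  assumes x: "5 \<le> x" and t: "0 \<le> t"
  shows "\<bar>occ x t + t * ((3 * x - 8) * occ x t) - (1 + 3 * x\<^sup>2 * t\<^sup>2 - 19 * x ^ 3 * t ^ 3)\<bar> \<le> 200 * err x t"
proof -
  have eq: "occ x t + t * ((3 * x - 8) * occ x t) - (1 + 3 * x\<^sup>2 * t\<^sup>2 - 19 * x ^ 3 * t ^ 3)
     = (48 * x - 64) * t\<^sup>2 - (96 * x\<^sup>2) * t ^ 3 - (55 * x ^ 3 * (3 * x - 8)) * t ^ 4"
    unfolding occ_def by (simp add: algebra_simps power2_eq_square power3_eq_cube power4_eq_xxxx)
  have "0 \<le> (48 * x - 64) * t\<^sup>2" "0 \<le> (96 * x\<^sup>2) * t ^ 3" "0 \<le> (55 * x ^ 3 * (3 * x - 8)) * t ^ 4"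
    using x t by simp_all
  moreover have "(48 * x - 64) * t\<^sup>2 \<le> (48 * x) * t\<^sup>2"
    "(55 * x ^ 3 * (3 * x - 8)) * t ^ 4 \<le> (55 * x ^ 3 * (3 * x)) * t ^ 4"
    using x t by (intro mult_right_mono mult_left_mono; simp)+
  moreover have "(48 * x) * t\<^sup>2 + (96 * x\<^sup>2) * t ^ 3 + (55 * x ^ 3 * (3 * x)) * t ^ 4 \<le> 200 * err x t"
    using x t unfolding err_def by (simp add: algebra_simps power4_eq_xxxx power3_eq_cube)
  ultimately show ?thesis unfolding eq by linarith
qed

lemma avoid_near_occ:
  assumes e: "e \<in> triples n" and n: "5 \<le> n" and t: "0 \<le> t" "(3 * real n - 8) * t \<le> 1 / 2"
  shows "\<bar>avoid n t {e} - occ (real n) t\<bar> \<le> 1200 * err (real n) t"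
proof -
  let ?x = "real n"
  \<comment> \<open>The maximal deviation \<open>d\<close> satisfies \<open>d \<le> 600 * err + (3 n - 8) * t * d\<close>,
    by subtracting the two local equations.\<close>
  define d where "d = Max ((\<lambda>f. \<bar>avoid n t {f} - occ ?x t\<bar>) ` triples n)"
  have d: "\<bar>avoid n t {f} - occ ?x t\<bar> \<le> d" if "f \<in> triples n" for f
    unfolding d_def using that by (intro Max_ge) auto
  have "d \<in> (\<lambda>f. \<bar>avoid n t {f} - occ ?x t\<bar>) ` triples n"
    unfolding d_def using e by (intro Max_in) auto
  then obtain g where g: "g \<in> triples n" and dg: "d = \<bar>avoid n t {g} - occ ?x t\<bar>" by blast
  have c: "real (card (nbhd n {g})) = 3 * ?x - 8"
    unfolding card_nbhd_singleton[OF g] using n by (simp add: of_nat_diff)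
  have "\<bar>(\<Sum>f\<in>nbhd n {g}. avoid n t {f}) - real (card (nbhd n {g})) * occ ?x t\<bar> \<le> real (card (nbhd n {g})) * d"
    using nbhd_subset_triples d by (intro sum_near) blast
  then have "t * \<bar>(\<Sum>f\<in>nbhd n {g}. avoid n t {f}) - (3 * ?x - 8) * occ ?x t\<bar> \<le> t * ((3 * ?x - 8) * d)"
    unfolding c using t(1) by (rule mult_left_mono)
  also have "\<dots> = (3 * ?x - 8) * t * d" by simp
  also have "\<dots> \<le> 1 / 2 * d" using t(2) dg by (intro mult_right_mono) auto
  finally have "\<bar>t * (\<Sum>f\<in>nbhd n {g}. avoid n t {f}) - t * ((3 * ?x - 8) * occ ?x t)\<bar> \<le> 1 / 2 * d"
    using t(1) by (simp add: abs_mult flip: right_diff_distrib)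
  moreover have "\<bar>avoid n t {g} + t * (\<Sum>f\<in>nbhd n {g}. avoid n t {f})
     - (1 + 3 * ?x\<^sup>2 * t\<^sup>2 - 19 * ?x ^ 3 * t ^ 3)\<bar> \<le> 400 * err ?x t"
    by (rule avoid_local_equation[OF g n t(1)])
  moreover have "\<bar>occ ?x t + t * ((3 * ?x - 8) * occ ?x t) - (1 + 3 * ?x\<^sup>2 * t\<^sup>2 - 19 * ?x ^ 3 * t ^ 3)\<bar> \<le> 200 * err ?x t"
    by (rule occ_local_equation) (use n t in auto)
  moreover have "\<bar>a - b\<bar> \<le> \<bar>a + S - K\<bar> + \<bar>b + P - K\<bar> + \<bar>S - P\<bar>" for a b S P K :: real
    by linarith
  ultimately have "d \<le> 400 * err ?x t + 200 * err ?x t + 1 / 2 * d"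
    unfolding dg by (smt (verit))
  then have "d \<le> 1200 * err ?x t" by simp
  then show ?thesis using d[OF e] by linarith
qed

section \<open>Integrating the logarithmic derivative\<close>

lemma partition_fun_0 [simp]: "partition_fun n 0 = 1"
proof -
  have "partition_fun n 0 = (\<Sum>I\<in>{{} :: nat set set}. 0 ^ card I)"
    unfolding partition_fun_def
    by (rule sum.mono_neutral_right) (auto simp: power_0_left finite_mem_L3)
  then show ?thesis by simp
qed

text \<open>The expected size of \<open>I\<close> is \<open>t * Z' t / Z t\<close> and also the sum
  of the occupation probabilities, each of which is \<open>t\<close> times an avoidance probability.
  Cancelling \<open>t\<close> is where \<open>0 < t\<close> enters.\<close>

lemma DERIV_ln_partition_fun:
  assumes t: "0 < t"
  shows "((\<lambda>s. ln (partition_fun n s)) has_real_derivative (\<Sum>e\<in>triples n. avoid n t {e})) (at t)"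
proof -
  have "(\<Sum>e\<in>triples n. incl n t {e}) = hc n t (\<lambda>I. real (card I))"
    unfolding hc_sum[symmetric]
  proof (rule hc_cong)
    fix I assume "I \<in> L3 n"
    then have "I \<inter> triples n = I" using L3_subset_triples by blast
    then show "(\<Sum>e\<in>triples n. of_bool ({e} \<subseteq> I)) = real (card I)"
      by (simp only: sum_of_bool_mem[OF finite_triples])
  qed
  moreover have "(\<Sum>e\<in>triples n. incl n t {e}) = t * (\<Sum>e\<in>triples n. avoid n t {e})"
    unfolding sum_distrib_left by (intro sum.cong incl_singleton) auto
  moreover have "hc n t (\<lambda>I. real (card I)) = t * ((\<Sum>I\<in>L3 n. real (card I) * t ^ (card I - 1)) / partition_fun n t)"
    unfolding hc_def times_divide_eq_right sum_distrib_left
  proof (intro arg_cong2[of _ _ _ _ "(/)"] sum.cong refl)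
    fix I :: "nat set set"
    show "t ^ card I * real (card I) = t * (real (card I) * t ^ (card I - 1))"
      \<comment> \<open>For \<open>card I = 0\<close> the truncated exponent
        \<open>card I - 1\<close> is harmless, both sides being 0.\<close>
      by (cases "card I") auto
  qed
  ultimately have "t * (\<Sum>e\<in>triples n. avoid n t {e}) =
      t * ((\<Sum>I\<in>L3 n. real (card I) * t ^ (card I - 1)) / partition_fun n t)" by metis
  then have "(\<Sum>e\<in>triples n. avoid n t {e}) = (\<Sum>I\<in>L3 n. real (card I) * t ^ (card I - 1)) / partition_fun n t"
    unfolding mult_cancel_left using t by blast
  moreover have "((\<lambda>s. partition_fun n s) has_real_derivative (\<Sum>I\<in>L3 n. real (card I) * t ^ (card I - 1))) (at t)"
    unfolding partition_fun_def by (auto intro!: derivative_eq_intros sum.cong)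
  ultimately show ?thesis
    using partition_fun_pos[of t n] t by (auto intro!: derivative_eq_intros)
qed

text \<open>The polynomial is the antiderivative of \<open>occ\<close> vanishing at 0. The mean
  value theorem is applied to the difference, whose derivative is bounded by summing the pointwise
  estimate over all triples.\<close>

lemma ln_partition_fun:
  assumes n: "5 \<le> n" and t: "0 \<le> t" "(3 * real n - 8) * t \<le> 1 / 2"
  defines "N \<equiv> real (n choose 3)"
  shows "\<bar>ln (partition_fun n t) - N * (t - (3 * real n - 8) / 2 * t\<^sup>2 + 4 * (real n)\<^sup>2 * t ^ 3 - 55 / 4 * real n ^ 3 * t ^ 4)\<bar>
     \<le> N * t * (1200 * err (real n) t)"
proof (cases "t = 0")
  case False
  then have t0: "0 < t" using t by simp
  define F where "F s = ln (partition_fun n s) - N * (s - (3 * real n - 8) / 2 * s\<^sup>2 + 4 * (real n)\<^sup>2 * s ^ 3 - 55 / 4 * real n ^ 3 * s ^ 4)" for s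
  define F' where "F' s = (\<Sum>e\<in>triples n. avoid n s {e}) - N * occ (real n) s" for s
  have der: "(F has_real_derivative F' s) (at s)" if "0 < s" for s
  proof -
    have "(F has_real_derivative (\<Sum>e\<in>triples n. avoid n s {e}) - N * (1 - (3 * real n - 8) / 2 * (2 * s)
        + 4 * (real n)\<^sup>2 * (3 * s\<^sup>2) - 55 / 4 * real n ^ 3 * (4 * s ^ 3))) (at s)"
      unfolding F_def by (intro DERIV_diff DERIV_ln_partition_fun that) (auto intro!: derivative_eq_intros)
    then show ?thesis unfolding F'_def occ_def by (rule DERIV_cong) (simp add: field_simps)
  qed
  have "continuous_on {0..t} F"
    unfolding F_def partition_fun_def
  proof (intro continuous_intros ballI)
    fix s assume "s \<in> {0..t}"
    then show "(\<Sum>I\<in>L3 n. s ^ card I) \<noteq> 0" using partition_fun_pos[of s n] unfolding partition_fun_def by simp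
  qed
  \<comment> \<open>Continuity on the closed interval and differentiability inside suffice, so the
    derivative formula is never evaluated at 0.\<close>
  then obtain l z where z: "0 < z" "z < t" "(F has_real_derivative l) (at z)" "F t - F 0 = (t - 0) * l"
    using MVT[of 0 t F] t0 der by (metis real_differentiable_def)
  have "l = F' z" using z(1,3) der DERIV_unique by blast
  have "\<bar>F' z\<bar> \<le> N * (1200 * err (real n) z)"
    unfolding F'_def N_def card_triples[symmetric]
  proof (rule sum_near)
    have "(3 * real n - 8) * z \<le> (3 * real n - 8) * t" using z n by (intro mult_left_mono) auto
    then have "(3 * real n - 8) * z \<le> 1 / 2" using t(2) by (rule order_trans)
    then show "\<bar>avoid n z {e} - occ (real n) z\<bar> \<le> 1200 * err (real n) z" if "e \<in> triples n" for e
      using that n z t by (intro avoid_near_occ) auto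
  qed
  also have "\<dots> \<le> N * (1200 * err (real n) t)"
    using z unfolding N_def by (intro mult_left_mono err_mono) auto
  finally have "t * \<bar>F' z\<bar> \<le> t * (N * (1200 * err (real n) t))" using t0 by (intro mult_left_mono) auto
  moreover have "F 0 = 0" unfolding F_def by simp
  ultimately have "\<bar>F t\<bar> \<le> t * (N * (1200 * err (real n) t))"
    using z(4) \<open>l = F' z\<close> t0 by (simp add: abs_mult)
  then show ?thesis unfolding F_def by (simp add: algebra_simps)
qed (use n in \<open>simp add: err_def\<close>)

section \<open>The probability of linearity\<close>

lemma pmf_H3:
  assumes p: "0 \<le> p" "p \<le> 1" and E: "E \<subseteq> triples n"
  shows "pmf (H3 n p) E = p ^ card E * (1 - p) ^ (card (triples n) - card E)"
proof -
  let ?M = "Pi_pmf (triples n) False (\<lambda>_. bernoulli_pmf p)"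
  have "pmf (H3 n p) E = measure_pmf.prob ?M ((\<lambda>b. {e \<in> triples n. b e}) -` {E})"
    unfolding H3_def by (simp add: pmf_map)
  \<comment> \<open>Many functions select the edge set \<open>E\<close>, but those differing from
    the default \<open>False\<close> outside \<open>triples n\<close> have probability 0, which
    leaves only the indicator of \<open>E\<close>.\<close>
  also have "\<dots> = measure_pmf.prob ?M {\<lambda>e. e \<in> E}"
  proof (rule measure_prob_cong_0)
    fix b assume b: "b \<in> (\<lambda>b. {e \<in> triples n. b e}) -` {E} - {\<lambda>e. e \<in> E}"
    show "pmf ?M b = 0"
    proof (rule pmf_Pi_outside[OF finite_triples])
      show "\<exists>e. e \<notin> triples n \<and> b e \<noteq> False"
        using b by auto
    qed
  qed (use E in auto)
  also have "\<dots> = (\<Prod>e\<in>triples n. pmf (bernoulli_pmf p) (e \<in> E))"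
    using E by (subst measure_pmf_single, subst pmf_Pi') auto
  also have "\<dots> = (\<Prod>e\<in>triples n. if e \<in> E then p else 1 - p)"
    using p by (intro prod.cong) auto
  also have "\<dots> = p ^ card E * (1 - p) ^ card (triples n - E)"
    using E by (simp add: prod.If_cases Int_absorb1 Diff_eq)
  finally show ?thesis using E by (simp add: card_Diff_subset finite_subset[OF E])
qed

lemma prob_L3:
  assumes p: "0 \<le> p" "p < 1"
  shows "measure_pmf.prob (H3 n p) (L3 n) = (1 - p) ^ (n choose 3) * partition_fun n (p / (1 - p))"
proof -
  have "measure_pmf.prob (H3 n p) (L3 n) = (\<Sum>E\<in>L3 n. pmf (H3 n p) E)"
    by (rule measure_measure_pmf_finite) simp
  also have "\<dots> = (\<Sum>E\<in>L3 n. (1 - p) ^ (n choose 3) * (p / (1 - p)) ^ card E)"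
  proof (rule sum.cong[OF refl])
    fix E assume "E \<in> L3 n"
    then have E: "E \<subseteq> triples n" by (rule L3_subset_triples)
    have "(1 - p) ^ (n choose 3) = (1 - p) ^ (card (triples n) - card E) * (1 - p) ^ card E"
      using card_mono[OF finite_triples E] by (simp add: card_triples flip: power_add)
    then show "pmf (H3 n p) E = (1 - p) ^ (n choose 3) * (p / (1 - p)) ^ card E"
      using p E by (simp add: pmf_H3 power_divide)
  qed
  finally show ?thesis unfolding partition_fun_def sum_distrib_left .
qed

section \<open>From fugacity back to edge probability\<close>

text \<open>The difference has derivative \<open>s\<^sup>2 / (1 + s)\<close>, which lies between 0
  and \<open>s\<^sup>2\<close>; the mean value theorem finishes.\<close>

lemma ln_one_plus_bound2:
  fixes t :: real
  assumes t: "0 \<le> t"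
  shows "\<bar>ln (1 + t) - (t - t\<^sup>2 / 2)\<bar> \<le> t ^ 3"
proof (cases "t = 0")
  case False
  define g where "g s = ln (1 + s) - (s - s\<^sup>2 / 2)" for s :: real
  have der: "(g has_real_derivative (s\<^sup>2 / (1 + s))) (at s)" if "0 \<le> s" for s
    unfolding g_def using that
    by (auto intro!: derivative_eq_intros simp: field_simps power2_eq_square)
  obtain z where z: "0 < z" "z < t" "g t - g 0 = (t - 0) * (z\<^sup>2 / (1 + z))"
    using MVT2[of 0 t g "\<lambda>s. s\<^sup>2 / (1 + s)"] der t False by auto
  have "z\<^sup>2 / (1 + z) \<le> z\<^sup>2 / 1" using z by (intro divide_left_mono) auto
  also have "\<dots> \<le> t\<^sup>2" using z by (simp add: power_mono)
  finally have "t * (z\<^sup>2 / (1 + z)) \<le> t * t\<^sup>2" using t by (rule mult_left_mono)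
  also have "t * t\<^sup>2 = t ^ 3" by (simp add: power2_eq_square power3_eq_cube)
  finally have "t * (z\<^sup>2 / (1 + z)) \<le> t ^ 3" .
  moreover have "g t = t * (z\<^sup>2 / (1 + z))" using z(3) unfolding g_def by simp
  moreover have "0 \<le> t * (z\<^sup>2 / (1 + z))" using t z by simp
  ultimately have "\<bar>g t\<bar> \<le> t ^ 3" by (simp only: abs_of_nonneg)
  then show ?thesis unfolding g_def .
qed simp

definition main_exponent :: "real \<Rightarrow> real \<Rightarrow> real" where
  "main_exponent x p = - (1 / 4) * x ^ 4 * p ^ 2 + 2 / 3 * x ^ 5 * p ^ 3
     - 55 / 24 * x ^ 6 * p ^ 4 + 3 / 2 * x ^ 3 * p ^ 2"

text \<open>Every monomial \<open>x ^ j * p ^ k\<close> here satisfies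
  \<open>5 * j \<le> 7 * k\<close>, with equality for the last, so all vanish in the limit when
  \<open>p = o(n powr (- 7 / 5))\<close>.\<close>

definition tail :: "real \<Rightarrow> real \<Rightarrow> real" where
  "tail x p = x ^ 2 * p ^ 2 + x ^ 4 * p ^ 3 + x ^ 5 * p ^ 4 + x ^ 7 * p ^ 5"

text \<open>The subtracted \<open>N * (t - t\<^sup>2 / 2)\<close> stands for
  \<open>N * ln (1 + t)\<close>, coming from \<open>(1 - p) ^ N\<close>, and cancels the linear
  term. Since \<open>t - p = p * t\<close>, replacing \<open>t ^ k\<close> by \<open>p ^ k\<close>
  costs only order \<open>p ^ (k + 1)\<close>.\<close>

lemma main_exponent_fugacity:
  fixes x p :: real
  defines "t \<equiv> p / (1 - p)" and "N \<equiv> x * (x - 1) * (x - 2) / 6"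
  assumes x: "5 \<le> x" and p: "0 \<le> p" "p \<le> 1 / 2"
  shows "\<bar>N * (t - (3 * x - 8) / 2 * t\<^sup>2 + 4 * x\<^sup>2 * t ^ 3 - 55 / 4 * x ^ 3 * t ^ 4)
      - N * (t - t\<^sup>2 / 2) - main_exponent x p\<bar> \<le> 1000 * tail x p"
proof -
  have t: "0 \<le> t" "p \<le> t" "t \<le> 2 * p" and tp: "t - p = p * t"
    unfolding t_def using p by (auto simp: field_simps mult_left_le)
  have d1: "t - p \<le> 2 * p\<^sup>2"
    unfolding tp using mult_left_mono[OF t(3) p(1)] by (simp add: power2_eq_square)
  have d: "0 \<le> t - p" using t by simp
  have "(t - p) * (t + p) \<le> 2 * p\<^sup>2 * (2 * p + p)"
    using d1 d t p by (intro mult_mono) auto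
  then have d2: "t\<^sup>2 - p\<^sup>2 \<le> 6 * p ^ 3" "0 \<le> t\<^sup>2 - p\<^sup>2"
    using t p by (auto simp: algebra_simps power2_eq_square power3_eq_cube intro: mult_mono)
  have "(t - p) * (t\<^sup>2 + t * p + p\<^sup>2) \<le> 2 * p\<^sup>2 * ((2 * p)\<^sup>2 + (2 * p) * p + p\<^sup>2)"
    using d1 d t p by (intro mult_mono add_mono power_mono) auto
  then have d3: "t ^ 3 - p ^ 3 \<le> 14 * p ^ 4"
    by (simp add: algebra_simps power2_eq_square power3_eq_cube power4_eq_xxxx)
  have d3': "0 \<le> t ^ 3 - p ^ 3" using t p by (simp add: power_mono)
  have "(t\<^sup>2 - p\<^sup>2) * (t\<^sup>2 + p\<^sup>2) \<le> 6 * p ^ 3 * ((2 * p)\<^sup>2 + p\<^sup>2)"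
    using d2 t p by (intro mult_mono add_mono power_mono) auto
  moreover have "(t\<^sup>2 - p\<^sup>2) * (t\<^sup>2 + p\<^sup>2) = t ^ 4 - p ^ 4" 
    by (simp add: algebra_simps flip: power_add)
  moreover have "6 * p ^ 3 * ((2 * p)\<^sup>2 + p\<^sup>2) = 30 * p ^ 5"
    by (simp add: algebra_simps flip: power_add)
  ultimately have d4: "t ^ 4 - p ^ 4 \<le> 30 * p ^ 5" "0 \<le> t ^ 4 - p ^ 4"
    using t p by (auto intro: power_mono)
  have t3: "t ^ 3 \<le> 8 * p ^ 3" and t4: "t ^ 4 \<le> 16 * p ^ 4"
    using power_mono[OF t(3,1), of 3] power_mono[OF t(3,1), of 4] by (simp_all add: power_mult_distrib)
  \<comment> \<open>The combined \<open>t\<^sup>2\<close> coefficient is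
    \<open>- 3 / 2 * (x - 3) * N = - Q / 4\<close>. Expanding \<open>Q\<close> yields both
    \<open>- 1 / 4 * x ^ 4\<close> and the correction \<open>3 / 2 * x ^ 3\<close>.\<close>
  define Q where "Q = x * (x - 1) * (x - 2) * (x - 3)"
  have Q: "0 \<le> Q" "Q \<le> x ^ 4"
  proof -
    show "0 \<le> Q" unfolding Q_def using x by simp
    have "Q \<le> x * x * x * x" unfolding Q_def using x by (intro mult_mono) auto
    then show "Q \<le> x ^ 4" by (simp add: power4_eq_xxxx)
  qed
  have eq: "N * (t - (3 * x - 8) / 2 * t\<^sup>2 + 4 * x\<^sup>2 * t ^ 3 - 55 / 4 * x ^ 3 * t ^ 4) - N * (t - t\<^sup>2 / 2) - main_exponent x p
    = - 1 / 4 * (Q * (t\<^sup>2 - p\<^sup>2)) - 1 / 4 * ((11 * x\<^sup>2 - 6 * x) * p\<^sup>2)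
      + 2 / 3 * (x ^ 5 * (t ^ 3 - p ^ 3)) - 2 / 3 * ((3 * x ^ 4 - 2 * x ^ 3) * t ^ 3)
      - 55 / 24 * (x ^ 6 * (t ^ 4 - p ^ 4)) + 55 / 24 * ((3 * x ^ 5 - 2 * x ^ 4) * t ^ 4)"
    unfolding N_def Q_def main_exponent_def
    by (simp add: field_simps) (simp add: algebra_simps power_numeral_reduce)
  have b1: "0 \<le> Q * (t\<^sup>2 - p\<^sup>2)" "Q * (t\<^sup>2 - p\<^sup>2) \<le> 6 * (x ^ 4 * p ^ 3)"
    using mult_mono[OF Q(2) d2(1)] Q d2 x by simp_all
  have b2: "0 \<le> (11 * x\<^sup>2 - 6 * x) * p\<^sup>2" "(11 * x\<^sup>2 - 6 * x) * p\<^sup>2 \<le> 11 * (x\<^sup>2 * p\<^sup>2)"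
  proof -
    have "6 * x \<le> 11 * x\<^sup>2" using x by (simp add: power2_eq_square)
    then show "0 \<le> (11 * x\<^sup>2 - 6 * x) * p\<^sup>2" by simp
    have "(11 * x\<^sup>2 - 6 * x) * p\<^sup>2 \<le> (11 * x\<^sup>2) * p\<^sup>2" using x by (intro mult_right_mono) auto
    then show "(11 * x\<^sup>2 - 6 * x) * p\<^sup>2 \<le> 11 * (x\<^sup>2 * p\<^sup>2)" by simp
  qed
  have b3: "0 \<le> x ^ 5 * (t ^ 3 - p ^ 3)" "x ^ 5 * (t ^ 3 - p ^ 3) \<le> 14 * (x ^ 5 * p ^ 4)"
    using mult_left_mono[OF d3, of "x ^ 5"] d3' x by simp_all
  have pos: "0 \<le> 3 * x ^ Suc k - 2 * x ^ k" "3 * x ^ Suc k - 2 * x ^ k \<le> 3 * x ^ Suc k" for k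
  proof -
    have "2 * x ^ k \<le> (3 * x) * x ^ k" using x by (intro mult_right_mono) auto
    then show "0 \<le> 3 * x ^ Suc k - 2 * x ^ k" by simp
    show "3 * x ^ Suc k - 2 * x ^ k \<le> 3 * x ^ Suc k" using x by simp
  qed
  have b4: "0 \<le> (3 * x ^ 4 - 2 * x ^ 3) * t ^ 3" "(3 * x ^ 4 - 2 * x ^ 3) * t ^ 3 \<le> 24 * (x ^ 4 * p ^ 3)"
    using mult_mono[OF pos(2)[of 3] t3] pos(1)[of 3] x t p by simp_all
  have b5: "0 \<le> x ^ 6 * (t ^ 4 - p ^ 4)" "x ^ 6 * (t ^ 4 - p ^ 4) \<le> 30 * (x ^ 7 * p ^ 5)"
  proof -
    show "0 \<le> x ^ 6 * (t ^ 4 - p ^ 4)" using d4 by simp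
    have "x ^ 6 * (t ^ 4 - p ^ 4) \<le> x ^ 7 * (30 * p ^ 5)"
      using x p d4 by (intro mult_mono power_increasing) auto
    then show "x ^ 6 * (t ^ 4 - p ^ 4) \<le> 30 * (x ^ 7 * p ^ 5)" by simp
  qed
  have b6: "0 \<le> (3 * x ^ 5 - 2 * x ^ 4) * t ^ 4" "(3 * x ^ 5 - 2 * x ^ 4) * t ^ 4 \<le> 48 * (x ^ 5 * p ^ 4)"
    using mult_mono[OF pos(2)[of 4] t4] pos(1)[of 4] x t p by simp_all
  have nn: "0 \<le> x\<^sup>2 * p\<^sup>2" "0 \<le> x ^ 4 * p ^ 3" "0 \<le> x ^ 5 * p ^ 4" "0 \<le> x ^ 7 * p ^ 5"
    using x p by simp_all
  \<comment> \<open>The largest coefficient in absolute value is \<open>55 / 24\<close>, below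
    3.\<close>
  have abs6: "\<bar>- 1 / 4 * a1 - 1 / 4 * a2 + 2 / 3 * a3 - 2 / 3 * a4 - 55 / 24 * a5 + 55 / 24 * a6\<bar>
     \<le> 3 * (a1 + a2 + a3 + a4 + a5 + a6)"
    if "0 \<le> a1" "0 \<le> a2" "0 \<le> a3" "0 \<le> a4" "0 \<le> a5" "0 \<le> a6" for a1 a2 a3 a4 a5 a6 :: real
    using that unfolding distrib_left by (intro abs_leI) linarith+
  have "\<bar>N * (t - (3 * x - 8) / 2 * t\<^sup>2 + 4 * x\<^sup>2 * t ^ 3 - 55 / 4 * x ^ 3 * t ^ 4)
      - N * (t - t\<^sup>2 / 2) - main_exponent x p\<bar> \<le> 
     3 * (6 * (x ^ 4 * p ^ 3) + 11 * (x\<^sup>2 * p\<^sup>2) + 14 * (x ^ 5 * p ^ 4) + 24 * (x ^ 4 * p ^ 3) + 30 * (x ^ 7 * p ^ 5)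
       + 48 * (x ^ 5 * p ^ 4))"
    unfolding eq
    by (rule order_trans[OF abs6[OF b1(1) b2(1) b3(1) b4(1) b5(1) b6(1)]])
      (intro mult_left_mono add_mono b1 b2 b3 b4 b5 b6, simp)
  also have "\<dots> \<le> 1000 * tail x p"
  proof -
    have "3 * (6 * b + 11 * a + 14 * c + 24 * b + 30 * d + 48 * c) \<le> 1000 * (a + b + c + d)"
      if "0 \<le> a" "0 \<le> b" "0 \<le> c" "0 \<le> d" for a b c d :: real
      using that by simp
    then show ?thesis unfolding tail_def using nn by blast
  qed
  finally show ?thesis .
qed

lemma real_choose_3: "3 \<le> n \<Longrightarrow> real (n choose 3) = real n * (real n - 1) * (real n - 2) / 6"
  by (simp add: binomial_gbinomial gbinomial_prod_rev numeral_3_eq_3 fact_numeral)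

text \<open>From \<open>1 - p = 1 / (1 + t)\<close> the logarithm is
  \<open>ln (partition_fun n t) - N * ln (1 + t)\<close>. The hypothesis
  \<open>12 * real n * p \<le> 1\<close> gives \<open>t \<le> 2 * p\<close> and then
  \<open>(3 * n - 8) * t \<le> 6 * n * p \<le> 1 / 2\<close>, as the contraction requires.\<close>

lemma ln_prob_L3:
  assumes n: "5 \<le> n" and p: "0 \<le> p" "12 * real n * p \<le> 1"
  shows "0 < measure_pmf.prob (H3 n p) (L3 n)"
    "\<bar>ln (measure_pmf.prob (H3 n p) (L3 n)) - main_exponent (real n) p\<bar> \<le> 100000 * tail (real n) p"
proof -
  define x where "x = real n"
  define N where "N = real (n choose 3)"
  define t where "t = p / (1 - p)"
  have x: "5 \<le> x" using n unfolding x_def by simp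
  have "5 * p \<le> x * p" using x p by (intro mult_right_mono) auto
  then have p2: "p \<le> 1 / 2" using p unfolding x_def by linarith
  have t: "0 \<le> t" "t \<le> 2 * p" unfolding t_def using p p2 by (auto simp: field_simps mult_left_le)
  have Neq: "N = x * (x - 1) * (x - 2) / 6" unfolding N_def x_def using n by (intro real_choose_3) simp
  have N: "0 \<le> N" "N \<le> x ^ 3"
  proof -
    have "x * (x - 1) * (x - 2) \<le> x * x * x" using x by (intro mult_mono) auto
    moreover have "0 \<le> x * x * x" using x by simp
    ultimately show "N \<le> x ^ 3" unfolding Neq power3_eq_cube by linarith
  qed (simp add: N_def)
  have P: "measure_pmf.prob (H3 n p) (L3 n) = (1 - p) ^ (n choose 3) * partition_fun n t"
    unfolding t_def using p p2 by (intro prob_L3) auto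
  show "0 < measure_pmf.prob (H3 n p) (L3 n)"
    unfolding P using p2 partition_fun_pos[OF t(1)] by simp
  have "1 - p = 1 / (1 + t)" unfolding t_def using p2 by (simp add: field_simps)
  then have "ln (1 - p) = - ln (1 + t)" using t by (simp add: ln_div)
  then have lnP: "ln (measure_pmf.prob (H3 n p) (L3 n)) = ln (partition_fun n t) - N * ln (1 + t)"
    unfolding P N_def using p2 partition_fun_pos[OF t(1), of n] by (simp add: ln_mult ln_realpow)
  have "(3 * x - 8) * t \<le> (3 * x) * (2 * p)" using x t p by (intro mult_mono) auto
  also have "\<dots> \<le> 1 / 2" using p unfolding x_def by simp
  finally have small: "(3 * x - 8) * t \<le> 1 / 2" .
  have e1: "\<bar>ln (partition_fun n t) - N * (t - (3 * x - 8) / 2 * t\<^sup>2 + 4 * x\<^sup>2 * t ^ 3 - 55 / 4 * x ^ 3 * t ^ 4)\<bar>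
      \<le> N * t * (1200 * err x t)"
    unfolding N_def x_def by (rule ln_partition_fun[OF n t(1) small[unfolded x_def]])
  have e2: "\<bar>N * (t - (3 * x - 8) / 2 * t\<^sup>2 + 4 * x\<^sup>2 * t ^ 3 - 55 / 4 * x ^ 3 * t ^ 4)
      - N * (t - t\<^sup>2 / 2) - main_exponent x p\<bar> \<le> 1000 * tail x p"
    unfolding Neq t_def by (rule main_exponent_fugacity[OF x p(1) p2])
  have "\<bar>N * ln (1 + t) - N * (t - t\<^sup>2 / 2)\<bar> = N * \<bar>ln (1 + t) - (t - t\<^sup>2 / 2)\<bar>"
    using N(1) by (simp add: abs_mult flip: right_diff_distrib)
  also have "\<dots> \<le> x ^ 4 * (2 * p) ^ 3"
  proof (intro mult_mono)
    show "N \<le> x ^ 4" using N(2) power_increasing[of 3 4 x] x by linarith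
    show "\<bar>ln (1 + t) - (t - t\<^sup>2 / 2)\<bar> \<le> (2 * p) ^ 3"
      using ln_one_plus_bound2[OF t(1)] power_mono[OF t(2,1), of 3] by linarith
  qed (use x in auto)
  finally have e3: "\<bar>N * ln (1 + t) - N * (t - t\<^sup>2 / 2)\<bar> \<le> 8 * (x ^ 4 * p ^ 3)"
    by (simp add: power_mult_distrib)
  have e4: "N * t * (1200 * err x t) \<le> 38400 * tail x p"
  proof -
    have "N * t * (1200 * err x t) \<le> x ^ 3 * (2 * p) * (1200 * err x (2 * p))"
      using N t p x by (intro mult_mono err_mono mult_nonneg_nonneg err_nonneg) auto
    also have "\<dots> = 9600 * (x ^ 4 * p ^ 3) + 19200 * (x ^ 5 * p ^ 4) + 38400 * (x ^ 7 * p ^ 5)"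
      unfolding err_def by (simp add: algebra_simps power_numeral_reduce)
    also have "\<dots> \<le> 38400 * tail x p"
    proof -
      have nn: "0 \<le> x\<^sup>2 * p\<^sup>2" "0 \<le> x ^ 4 * p ^ 3" "0 \<le> x ^ 5 * p ^ 4" "0 \<le> x ^ 7 * p ^ 5"
        using x p by simp_all
      have "9600 * b + 19200 * c + 38400 * d \<le> 38400 * (a + b + c + d)"
        if "0 \<le> a" "0 \<le> b" "0 \<le> c" "0 \<le> d" for a b c d :: real
        using that by simp
      then show ?thesis unfolding tail_def using nn by blast
    qed
    finally show ?thesis .
  qed
  have e5: "8 * (x ^ 4 * p ^ 3) \<le> 8 * tail x p" unfolding tail_def using x p by simp
  have e6: "0 \<le> tail x p" unfolding tail_def using x p by simp
  show "\<bar>ln (measure_pmf.prob (H3 n p) (L3 n)) - main_exponent (real n) p\<bar> \<le> 100000 * tail (real n) p"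
    unfolding lnP x_def[symmetric] using e1 e2 e3 e4 e5 e6 by linarith
qed

section \<open>The asymptotic statement\<close>

lemma power_le_powr_power:
  fixes x :: real
  assumes "1 \<le> x" "5 * j \<le> 7 * k"
  shows "x ^ j \<le> (x powr (7 / 5)) ^ k"
proof -
  have "x ^ j = x powr real j" using assms by (simp add: powr_realpow)
  also have "\<dots> \<le> x powr (7 / 5 * real k)" using assms by (intro powr_mono) linarith+
  also have "\<dots> = (x powr (7 / 5)) ^ k" using assms by (simp add: powr_powr flip: powr_realpow)
  finally show ?thesis .
qed

theorem corollary2p2:
  fixes p :: "nat \<Rightarrow> real"
  assumes prob: "\<And>n. 0 \<le> p n \<and> p n \<le> 1"
    and small: "p \<in> o(\<lambda>n. real n powr (- 7 / 5))"
  shows "\<exists>\<epsilon> :: nat \<Rightarrow> real. \<epsilon> \<in> o(\<lambda>_. 1) \<and>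
    (\<forall>\<^sub>F n in sequentially.
       measure_pmf.prob (H3 n (p n)) (L3 n) =
         exp (- (1 / 4) * real n ^ 4 * p n ^ 2 + 2 / 3 * real n ^ 5 * p n ^ 3
              - 55 / 24 * real n ^ 6 * p n ^ 4 + 3 / 2 * real n ^ 3 * p n ^ 2 + \<epsilon> n))"
proof -
  \<comment> \<open>The rescaled probability: smallness of \<open>p\<close> means \<open>u\<close>
    tends to 0, and every monomial of \<open>tail\<close> is at most a power of
    \<open>u\<close>.\<close>
  define u where "u n = real n powr (7 / 5) * p n" for n
  \<comment> \<open>With the error defined outright, the claimed identity only needs the probability
    to be positive, which holds for all large \<open>n\<close>.\<close>
  define \<epsilon> where "\<epsilon> n = ln (measure_pmf.prob (H3 n (p n)) (L3 n)) - main_exponent (real n) (p n)" for n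
  have "(\<lambda>n. p n / real n powr (- 7 / 5)) \<longlonglongrightarrow> 0"
    using smalloD_tendsto[OF small] .
  then have u: "u \<longlonglongrightarrow> 0"
    unfolding u_def by (simp add: powr_minus field_simps)
  have le: "real n ^ j * p n ^ k \<le> u n ^ k" if "1 \<le> n" "5 * j \<le> 7 * k" for n j k
    unfolding u_def power_mult_distrib
    by (intro mult_right_mono power_le_powr_power) (use that prob in auto)
  have "\<forall>\<^sub>F n in sequentially. u n < 1 / 12"
    using u by (rule order_tendstoD) simp
  then have good: "\<forall>\<^sub>F n in sequentially. 5 \<le> n \<and> 12 * real n * p n \<le> 1"
    using eventually_ge_at_top[of 5]
  proof eventually_elim
    case (elim n)
    \<comment> \<open>The case \<open>j = k = 1\<close> bounds \<open>n * p n\<close> by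
      \<open>u n\<close>, which is below \<open>1 / 12\<close>.\<close>
    then show ?case using le[of n 1 1] by simp
  qed
  have bound: "\<forall>\<^sub>F n in sequentially. \<bar>\<epsilon> n\<bar> \<le> 100000 * (u n ^ 2 + u n ^ 3 + u n ^ 4 + u n ^ 5)"
    using good
  proof eventually_elim
    case (elim n)
    have "\<bar>\<epsilon> n\<bar> \<le> 100000 * tail (real n) (p n)"
      unfolding \<epsilon>_def using elim prob by (intro ln_prob_L3) auto
    also have "\<dots> \<le> 100000 * (u n ^ 2 + u n ^ 3 + u n ^ 4 + u n ^ 5)"
      unfolding tail_def using elim by (intro mult_left_mono add_mono le) auto
    finally show ?case .
  qed
  have "(\<lambda>n. 100000 * (u n ^ 2 + u n ^ 3 + u n ^ 4 + u n ^ 5)) \<longlonglongrightarrow> 100000 * (0 ^ 2 + 0 ^ 3 + 0 ^ 4 + 0 ^ 5)"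
    by (intro tendsto_intros u)
  then have "\<epsilon> \<longlonglongrightarrow> 0"
    using bound by (intro Lim_null_comparison[of \<epsilon>]) (auto simp: real_norm_def)
  then have "\<epsilon> \<in> o(\<lambda>_. 1)" by (intro smalloI_tendsto) auto
  moreover have "\<forall>\<^sub>F n in sequentially. measure_pmf.prob (H3 n (p n)) (L3 n) =
         exp (- (1 / 4) * real n ^ 4 * p n ^ 2 + 2 / 3 * real n ^ 5 * p n ^ 3
              - 55 / 24 * real n ^ 6 * p n ^ 4 + 3 / 2 * real n ^ 3 * p n ^ 2 + \<epsilon> n)"
    using good
  proof eventually_elim
    case (elim n)
    then have "0 < measure_pmf.prob (H3 n (p n)) (L3 n)" using prob by (intro ln_prob_L3) auto
    then have "measure_pmf.prob (H3 n (p n)) (L3 n) = exp (main_exponent (real n) (p n) + \<epsilon> n)"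
      unfolding \<epsilon>_def by simp
    then show ?case unfolding main_exponent_def .
  qed
  ultimately show ?thesis by blast
qed

end
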